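(* Suppose that $\beta=0$ and $p\in(1/2,1]$. For any $S_0\in\mathcal{D}$ and any $s\in[0,\infty)$, $$\mathbb{E}_{0,p}[\tau^{s}\mid\xi_0=S_0]<\infty .$$
   Context: Configurations: let $\mathcal{D}'\subset\{0,1\}^{\mathbb{Z}}$ be the set of configurations with finitely many $0$'s to the left of the origin and finitely many $1$'s to the right. Call $S,S'\in\mathcal{D}'$ equivalent if they are translates of each other, and let $\mathcal{D}$ be the (countable) set of equivalence classes. So each $S\in\mathcal{D}$ is an infinite string of $1$'s, followed by a finite string of $0$'s and $1$'s, followed by an infinite string of $0$'s, modulo translation. The ground state is $\mathcal{D}_0=\ldots 111000\ldots$ (up to translation). An unlike pair is a pair of adjacent sites with labels $01$ or $10$ (read left to right); each configuration has finitely many of them and at least one. Process: for $\beta,p\in[0,1]$ the discrete-time exclusion-voter process $\xi=(\xi_t)_{t\in\mathbb{Z}^+}$, $\mathbb{Z}^+=\{0,1,2,\ldots\}$, is the time-homogeneous Markov chain on $\mathcal{D}$ with the following one-step dynamics. At each time step, independently, a voter move is chosen with probability $\beta$ and an exclusion move with probability $1-\beta$; then one of the unlike pairs of the current configuration is chosen uniformly at random. In a voter move the chosen pair is replaced by $00$ or by $11$, each with probability $1/2$. In an exclusion move, a chosen pair $01$ becomes $10$ with probability $p$ (otherwise no change), and a chosen pair $10$ becomes $01$ with probability $1-p$ (otherwise no change). Its law and expectation are denoted $\mathbb{P}_{\beta,p}$, $\mathbb{E}_{\beta,p}$. (For $\beta=0$ only exclusion moves occur.) Relaxation time: $\tau=\min\{t\in\mathbb{N}:\xi_t=\mathcal{D}_0\}$,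 $\mathbb{N}=\{1,2,\ldots\}$, with $\tau=+\infty$ if there is no such $t$. *)

theory Defs
  imports "HOL-Probability.Probability"
begin

text \<open>
  A bi-infinite configuration is a function \<open>S :: int \<Rightarrow> bool\<close>, with \<^term>\<open>True\<close> for the label 1
  and \<^term>\<open>False\<close> for the label 0.
\<close>

definition pre_configs :: "(int \<Rightarrow> bool) set" where
  "pre_configs = {S. finite {x. x < 0 \<and> \<not> S x} \<and> finite {x. x > 0 \<and> S x}}"

definition translates :: "((int \<Rightarrow> bool) \<times> (int \<Rightarrow> bool)) set" where
  "translates = {(S, S'). S \<in> pre_configs \<and> S' \<in> pre_configs \<and> (\<exists>k. \<forall>x. S' x = S (x + k))}"

definition configs :: "(int \<Rightarrow> bool) set set" where
  "configs = pre_configs // translates"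

definition config_class :: "(int \<Rightarrow> bool) \<Rightarrow> (int \<Rightarrow> bool) set" where
  "config_class S = translates `` {S}"

definition ground_state :: "(int \<Rightarrow> bool) set" where
  "ground_state = config_class (\<lambda>x. x < 0)"

text \<open>An unlike pair is identified with the position of its left site.\<close>

definition unlike_pairs :: "(int \<Rightarrow> bool) \<Rightarrow> int set" where
  "unlike_pairs S = {x. S x \<noteq> S (x + 1)}"

definition voter_move :: "(int \<Rightarrow> bool) \<Rightarrow> int \<Rightarrow> (int \<Rightarrow> bool) pmf" where
  "voter_move S x = map_pmf (\<lambda>b. S(x := b, x + 1 := b)) (bernoulli_pmf (1 / 2))"

text \<open>
  Only used at unlike pairs, so \<open>S x\<close> says that the pair reads 10 and \<open>\<not> S x\<close> that it reads 01.
\<close>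

definition exclusion_move :: "real \<Rightarrow> (int \<Rightarrow> bool) \<Rightarrow> int \<Rightarrow> (int \<Rightarrow> bool) pmf" where
  "exclusion_move p S x =
     (if S x
      then map_pmf (\<lambda>b. if b then S(x := False, x + 1 := True) else S) (bernoulli_pmf (1 - p))
      else map_pmf (\<lambda>b. if b then S(x := True, x + 1 := False) else S) (bernoulli_pmf p))"

definition pre_step :: "real \<Rightarrow> real \<Rightarrow> (int \<Rightarrow> bool) \<Rightarrow> (int \<Rightarrow> bool) pmf" where
  "pre_step \<beta> p S =
     bind_pmf (bernoulli_pmf \<beta>) (\<lambda>voter.
     bind_pmf (pmf_of_set (unlike_pairs S)) (\<lambda>x.
       if voter then voter_move S x else exclusion_move p S x))"

text \<open>
  The induced kernel on equivalence classes; by \<open>step_config_class\<close> below it does not depend on the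
  chosen representative.
\<close>

definition step :: "real \<Rightarrow> real \<Rightarrow> (int \<Rightarrow> bool) set \<Rightarrow> (int \<Rightarrow> bool) set pmf" where
  "step \<beta> p C = map_pmf config_class (pre_step \<beta> p (SOME S. S \<in> C))"

locale exclusion_voter_process = prob_space M
  for M :: "'w measure" and \<beta> p :: real and \<xi> :: "nat \<Rightarrow> 'w \<Rightarrow> (int \<Rightarrow> bool) set" +
  assumes parameters: "\<beta> \<in> {0..1}" "p \<in> {0..1}"
    and random_state: "\<And>t. \<xi> t \<in> measurable M (count_space configs)"
    and markov: "\<And>t c C. prob {\<omega> \<in> space M. \<forall>i\<le>t. \<xi> i \<omega> = c i} > 0 \<Longrightarrow>
      \<P>(\<omega> in M. \<xi> (Suc t) \<omega> = C \<bar> \<forall>i\<le>t. \<xi> i \<omega> = c i) = pmf (step \<beta> p (c t)) C"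

text \<open>The infimum of the empty set is \<open>\<infinity>\<close>.\<close>

definition relaxation_time :: "(nat \<Rightarrow> 'w \<Rightarrow> (int \<Rightarrow> bool) set) \<Rightarrow> 'w \<Rightarrow> enat" where
  "relaxation_time \<xi> \<omega> = Inf (enat ` {t. 1 \<le> t \<and> \<xi> t \<omega> = ground_state})"

text \<open>Used for \<open>s \<ge> 0\<close> only, with the convention \<open>\<infinity>\<^sup>0 = 1\<close>.\<close>

definition enat_powr :: "enat \<Rightarrow> real \<Rightarrow> ennreal" where
  "enat_powr n s =
     (case n of enat k \<Rightarrow> ennreal (real k powr s) | \<infinity> \<Rightarrow> if s = 0 then 1 else \<infinity>)"


subsection \<open>The step kernel is well defined, and the process exists from every initial state\<close>

lemma equiv_translates: "equiv pre_configs translates"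
proof (rule equivI)
  show "translates \<subseteq> pre_configs \<times> pre_configs"
    by (auto simp: translates_def)
  show "refl_on pre_configs translates"
    by (auto simp: refl_on_def translates_def intro: exI[of _ 0])
  show "sym translates"
  proof (rule symI)
    fix S S' assume "(S, S') \<in> translates"
    then obtain k where k: "S \<in> pre_configs" "S' \<in> pre_configs" "\<And>x. S' x = S (x + k)"
      by (auto simp: translates_def)
    then have "\<forall>x. S x = S' (x + (- k))" by simp
    with k(1,2) show "(S', S) \<in> translates" unfolding translates_def by blast
  qed
  show "trans translates"
  proof (rule transI)
    fix S S' S'' assume "(S, S') \<in> translates" "(S', S'') \<in> translates"
    then obtain k l where k: "S \<in> pre_configs" "S'' \<in> pre_configs"
        "\<And>x. S' x = S (x + k)" "\<And>x. S'' x = S' (x + l)"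
      by (auto simp: translates_def)
    then have "\<forall>x. S'' x = S (x + (l + k))" by (simp add: add.assoc)
    with k(1,2) show "(S, S'') \<in> translates" unfolding translates_def by blast
  qed
qed

lemma ground_state_in_configs: "ground_state \<in> configs"
proof -
  have "(\<lambda>x::int. x < 0) \<in> pre_configs"
    by (auto simp: pre_configs_def intro!: finite_subset[of _ "{}"])
  then show ?thesis
    by (auto simp: ground_state_def config_class_def configs_def intro: quotientI)
qed

lemma config_class_eq_iff:
  "S \<in> pre_configs \<Longrightarrow> S' \<in> pre_configs \<Longrightarrow>
   config_class S = config_class S' \<longleftrightarrow> (S, S') \<in> translates"
  unfolding config_class_def by (rule eq_equiv_class_iff[OF equiv_translates])

lemma pre_configs_cofinite:
  assumes "S \<in> pre_configs"
  obtains a b where "a \<le> b" "\<And>x. x < a \<Longrightarrow> S x" "\<And>x. x > b \<Longrightarrow> \<not> S x"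
proof -
  let ?A = "{x. x < 0 \<and> \<not> S x}" and ?B = "{x. x > 0 \<and> S x}"
  have f: "finite ?A" "finite ?B" using assms by (auto simp: pre_configs_def)
  define a where "a = Min (insert 0 ?A)"
  define b where "b = Max (insert 0 ?B)"
  have "a \<le> 0" "0 \<le> b" using f by (auto simp: a_def b_def)
  moreover have "S x" if "x < a" for x
    using that f \<open>a \<le> 0\<close> Min_le[of "insert 0 ?A" x] by (fastforce simp: a_def)
  moreover have "\<not> S x" if "x > b" for x
    using that f \<open>0 \<le> b\<close> Max_ge[of "insert 0 ?B" x] by (fastforce simp: b_def)
  ultimately show thesis using that[of a b] by auto
qed

lemma pre_configsI:
  assumes "\<And>x. x < a \<Longrightarrow> S x" "\<And>x. x > b \<Longrightarrow> \<not> S x"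
  shows "S \<in> pre_configs"
proof -
  have "{x. x < 0 \<and> \<not> S x} \<subseteq> {a..0}" "{x. x > 0 \<and> S x} \<subseteq> {0..b}"
    using assms by (auto simp: not_less[symmetric] less_imp_le)
  then show ?thesis
    by (auto simp: pre_configs_def intro: finite_subset)
qed

lemma finite_unlike_pairs:
  assumes "S \<in> pre_configs" shows "finite (unlike_pairs S)"
proof -
  obtain a b where ab: "a \<le> b" "\<And>x. x < a \<Longrightarrow> S x" "\<And>x. x > b \<Longrightarrow> \<not> S x"
    using pre_configs_cofinite[OF assms] by blast
  have "unlike_pairs S \<subseteq> {a - 1..b}"
  proof
    fix x assume x: "x \<in> unlike_pairs S"
    show "x \<in> {a - 1..b}"
    proof (rule ccontr)
      assume "x \<notin> {a - 1..b}"
      then have "x + 1 < a \<or> x > b" by auto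
      then show False using ab(2)[of x] ab(2)[of "x + 1"] ab(3)[of x] ab(3)[of "x + 1"] x
        by (auto simp: unlike_pairs_def)
    qed
  qed
  then show ?thesis by (rule finite_subset) simp
qed

lemma unlike_pairs_nonempty:
  assumes "S \<in> pre_configs" shows "unlike_pairs S \<noteq> {}"
proof
  assume e: "unlike_pairs S = {}"
  obtain a b where ab: "a \<le> b" "\<And>x. x < a \<Longrightarrow> S x" "\<And>x. x > b \<Longrightarrow> \<not> S x"
    using pre_configs_cofinite[OF assms] by blast
  have "S (a - 1 + int n)" for n
  proof (induction n)
    case 0 then show ?case using ab(2)[of "a - 1"] by simp
  next
    case (Suc n)
    have "S (a - 1 + int n) = S (a - 1 + int n + 1)" using e unfolding unlike_pairs_def by blast
    with Suc show ?case by (simp add: algebra_simps)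
  qed
  from this[of "nat (b - a + 2)"] ab(1) ab(3)[of "b + 1"] show False by (simp add: add.commute)
qed

lemma fun_upd_pre_configs:
  assumes "S \<in> pre_configs" shows "S(x := c) \<in> pre_configs"
proof -
  obtain a b where ab: "a \<le> b" "\<And>x. x < a \<Longrightarrow> S x" "\<And>x. x > b \<Longrightarrow> \<not> S x"
    using pre_configs_cofinite[OF assms] by blast
  show ?thesis
    by (rule pre_configsI[of "min a x" _ "max b x"]) (use ab in auto)
qed

lemma set_pre_step: "S \<in> pre_configs \<Longrightarrow> set_pmf (pre_step \<beta> p S) \<subseteq> pre_configs"
  by (auto simp: pre_step_def voter_move_def exclusion_move_def
      intro!: fun_upd_pre_configs split: if_splits)

lemma pre_step_translate:
  assumes S: "S \<in> pre_configs" and S': "S' = (\<lambda>x. S (x + k))"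
  shows "pre_step \<beta> p S' = map_pmf (\<lambda>T x. T (x + k)) (pre_step \<beta> p S)"
proof -
  have U: "unlike_pairs S' = (\<lambda>x. x - k) ` unlike_pairs S"
  proof (intro equalityI subsetI)
    fix x assume "x \<in> unlike_pairs S'"
    then have "x + k \<in> unlike_pairs S" by (simp add: S' unlike_pairs_def algebra_simps)
    then show "x \<in> (\<lambda>x. x - k) ` unlike_pairs S" by (intro image_eqI[of _ _ "x + k"]) auto
  qed (auto simp: S' unlike_pairs_def algebra_simps)
  have P: "pmf_of_set (unlike_pairs S') = map_pmf (\<lambda>x. x - k) (pmf_of_set (unlike_pairs S))"
    unfolding U using finite_unlike_pairs[OF S] unlike_pairs_nonempty[OF S]
    by (intro map_pmf_of_set_inj[symmetric]) (auto simp: inj_on_def)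
  have upd: "S'(x - k := c, x - k + 1 := d) = (\<lambda>y. (S(x := c, x + 1 := d)) (y + k))" for x c d
    by (auto simp: S' fun_eq_iff)
  have V: "voter_move S' (x - k) = map_pmf (\<lambda>T y. T (y + k)) (voter_move S x)" for x
    unfolding voter_move_def map_pmf_comp upd ..
  have E: "exclusion_move p S' (x - k) = map_pmf (\<lambda>T y. T (y + k)) (exclusion_move p S x)" for x
  proof -
    have "S' (x - k) = S x" by (simp add: S')
    then show ?thesis
      unfolding exclusion_move_def upd
      by (auto simp: map_pmf_comp S' intro!: map_pmf_cong)
  qed
  show ?thesis
    unfolding pre_step_def P map_bind_pmf bind_map_pmf
    by (intro bind_pmf_cong refl) (simp add: V E)
qed

lemma step_config_class:
  assumes S: "S \<in> pre_configs"
  shows "step \<beta> p (config_class S) = map_pmf config_class (pre_step \<beta> p S)"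
proof -
  let ?S' = "SOME T. T \<in> config_class S"
  have "S \<in> config_class S"
    unfolding config_class_def by (rule equiv_class_self[OF equiv_translates S])
  then have "?S' \<in> config_class S" by (rule someI[where P = "\<lambda>T. T \<in> config_class S"])
  then have "\<exists>k. \<forall>x. ?S' x = S (x + k)"
    unfolding config_class_def translates_def by blast
  then obtain k where k: "?S' = (\<lambda>x. S (x + k))"
    by (auto simp only: fun_eq_iff)
  have "config_class (\<lambda>x. T (x + k)) = config_class T" if T: "T \<in> pre_configs" for T
  proof -
    obtain a b where ab: "a \<le> b" "\<And>x. x < a \<Longrightarrow> T x" "\<And>x. x > b \<Longrightarrow> \<not> T x"
      using pre_configs_cofinite[OF T] by blast
    have T': "(\<lambda>x. T (x + k)) \<in> pre_configs"
      by (rule pre_configsI[of "a - k" _ "b - k"]) (use ab in auto)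
    then have "(T, \<lambda>x. T (x + k)) \<in> translates" using T by (auto simp: translates_def)
    then show ?thesis using config_class_eq_iff[OF T T'] by simp
  qed
  then show ?thesis
    unfolding step_def pre_step_translate[OF S k] map_pmf_comp
    using set_pre_step[OF S] by (intro map_pmf_cong) auto
qed

lemma set_step: assumes "C \<in> configs" shows "set_pmf (step \<beta> p C) \<subseteq> configs"
proof -
  obtain S where S: "S \<in> pre_configs" "C = config_class S"
    using assms by (auto simp: configs_def config_class_def elim: quotientE)
  have "config_class T \<in> configs" if "T \<in> pre_configs" for T
    using that unfolding configs_def config_class_def by (rule quotientI)
  then show ?thesis
    using set_pre_step[OF S(1), of \<beta> p] unfolding S(2) step_config_class[OF S(1)] by auto
qed

lemma exclusion_voter_process_exists:
  assumes parameters: "\<beta> \<in> {0..1}" "p \<in> {0..1}" and S0: "S\<^sub>0 \<in> configs"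
  shows "\<exists>(M :: (nat \<Rightarrow> (int \<Rightarrow> bool) set) measure) \<xi>.
    exclusion_voter_process M \<beta> p \<xi> \<and> measure M {\<omega> \<in> space M. \<xi> 0 \<omega> = S\<^sub>0} = 1"
proof -
  define K where "K C = restrict_space (measure_pmf (step \<beta> p C)) configs" for C
  define P where "P n \<omega> = (case n of 0 \<Rightarrow> return (count_space configs) S\<^sub>0 | Suc m \<Rightarrow> K (\<omega> m))"
    for n and \<omega> :: "nat \<Rightarrow> (int \<Rightarrow> bool) set"
  let ?N = "count_space configs"
  have sets_K: "sets (K C) = sets ?N" for C
    by (simp add: K_def sets_restrict_space) blast
  have em_K: "emeasure (K C) A = emeasure (measure_pmf (step \<beta> p C)) A" if "A \<subseteq> configs" for A C
    using that unfolding K_def by (intro emeasure_restrict_space) auto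
  have prob_K: "prob_space (K C)" if "C \<in> configs" for C
  proof (rule prob_spaceI)
    have "emeasure (measure_pmf (step \<beta> p C)) configs = 1"
      using set_step[OF that, of \<beta> p]
      by (intro measure_pmf.emeasure_eq_1_AE) (auto simp: AE_measure_pmf_iff)
    then show "emeasure (K C) (space (K C)) = 1"
      using em_K[of configs C] by (simp add: K_def space_restrict_space)
  qed
  have K_meas: "K \<in> ?N \<rightarrow>\<^sub>M subprob_algebra ?N"
    by (auto simp: space_subprob_algebra sets_K intro!: prob_space_imp_subprob_space prob_K)
  have P_meas: "P n \<in> PiM {0..<n} (\<lambda>_. ?N) \<rightarrow>\<^sub>M subprob_algebra ?N" for n
  proof (cases n)
    case 0
    have "return ?N S\<^sub>0 \<in> space (subprob_algebra ?N)"
      using S0 by (auto simp: space_subprob_algebra intro!: prob_space_imp_subprob_space prob_space_return)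
    then show ?thesis by (simp add: 0 P_def[abs_def])
  next
    case (Suc m)
    have "(\<lambda>\<omega>. K (\<omega> m)) \<in> PiM {0..<Suc m} (\<lambda>_. ?N) \<rightarrow>\<^sub>M subprob_algebra ?N"
      by (rule measurable_compose[OF _ K_meas]) (rule measurable_component_singleton, simp)
    then show ?thesis by (simp add: Suc P_def[abs_def])
  qed
  have P_prob: "prob_space (P n \<omega>)" if "\<omega> \<in> space (PiM {0..<n} (\<lambda>_. ?N))" for n \<omega>
    using that S0 by (auto simp: P_def space_PiM PiE_iff split: nat.splits intro!: prob_K prob_space_return)
  interpret IT: Ionescu_Tulcea P "\<lambda>_. ?N"
    by (rule Ionescu_Tulcea.intro[OF P_meas P_prob])
  let ?L = "IT.PF.lim"
  have space_L: "space ?L = UNIV \<rightarrow> configs"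
    by (simp add: space_PiM PiE_def)
  have sing: "{restrict c {0..<n}} \<in> sets (PiM {0..<n} (\<lambda>_. ?N))" if "\<And>i. i < n \<Longrightarrow> c i \<in> configs" for c and n :: nat
  proof -
    have "{restrict c {0..<n}} = PiE {0..<n} (\<lambda>i. {restrict c {0..<n} i})"
      by (rule PiE_singleton[symmetric]) simp
    also have "\<dots> = PiE {0..<n} (\<lambda>i. {c i})"
      by (rule PiE_cong) simp
    also have "\<dots> \<in> sets (PiM {0..<n} (\<lambda>_. ?N))"
      using that by (intro sets_PiM_I_finite) auto
    finally show ?thesis .
  qed
  define q where "q n c = emeasure (IT.C 0 n (\<lambda>_. undefined)) {restrict c {0..<n}}" for n c
  have L_q: "emeasure ?L {\<omega> \<in> space ?L. \<forall>i<n. \<omega> i = c i} = q n c"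
    if c: "\<And>i. i < n \<Longrightarrow> c i \<in> configs" for n c
  proof -
    have "{\<omega> \<in> space ?L. \<forall>i<n. \<omega> i = c i} = IT.PF.emb UNIV {0..<n} {restrict c {0..<n}}"
    proof -
      have "restrict \<omega> {0..<n} = restrict c {0..<n} \<longleftrightarrow> (\<forall>i<n. \<omega> i = c i)" for \<omega>
        by (auto simp: fun_eq_iff restrict_def)
      then show ?thesis
        by (auto simp: prod_emb_def space_PiM PiE_def)
    qed
    then have "emeasure ?L {\<omega> \<in> space ?L. \<forall>i<n. \<omega> i = c i} = emeasure (IT.CI {0..<n}) {restrict c {0..<n}}"
      using IT.lim[OF _ sing[OF c]] by simp
    also have "\<dots> = emeasure (IT.C 0 n (\<lambda>_. undefined)) (IT.PF.emb {0..<n} {0..<n} {restrict c {0..<n}})"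
      by (rule IT.emeasure_CI[OF _ sing[OF c]]) auto
    also have "IT.PF.emb {0..<n} {0..<n} {restrict c {0..<n}} = {restrict c {0..<n}}"
      using sets.sets_into_space[OF sing[OF c]] by (intro prod_emb_id) (auto simp: space_PiM)
    finally show ?thesis by (simp add: q_def)
  qed
  have q_Suc: "q (Suc n) c = q n c * emeasure (P n (restrict c {0..<n})) {c n}"
    if c: "\<And>i. i \<le> n \<Longrightarrow> c i \<in> configs" for n c
  proof -
    let ?C = "IT.C 0 n (\<lambda>_. undefined)"
    have u: "(\<lambda>_::nat. undefined) \<in> space (PiM {0..<0} (\<lambda>_. ?N))" by (simp add: space_PiM)
    have sC: "sets ?C = sets (PiM {0..<n} (\<lambda>_. ?N))" "space ?C = space (PiM {0..<n} (\<lambda>_. ?N))"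
      using IT.sets_C[OF u, of n] IT.space_C[OF u, of n] by simp_all
    have sS: "{restrict c {0..<Suc n}} \<in> sets (PiM {0..<Suc n} (\<lambda>_. ?N))"
      using c by (intro sing) auto
    have sn: "{restrict c {0..<n}} \<in> sets ?C"
      unfolding sC using c by (intro sing) auto
    have ne: "space ?C \<noteq> {}"
      using sets.sets_into_space[OF sn] by auto
    have "q (Suc n) c = (\<integral>\<^sup>+\<omega>. emeasure (IT.eP n \<omega>) {restrict c {0..<Suc n}} \<partial>?C)"
      unfolding q_def IT.C.simps using ne
      by (subst emeasure_bind[OF _ _ sS]) (auto simp: measurable_cong_sets[OF sC(1) refl])
    also have "\<dots> = (\<integral>\<^sup>+\<omega>. emeasure (P n (restrict c {0..<n})) {c n} * indicator {restrict c {0..<n}} \<omega> \<partial>?C)"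
    proof (rule nn_integral_cong)
      fix \<omega> assume "\<omega> \<in> space ?C"
      then have w: "\<omega> \<in> space (PiM {0..<n} (\<lambda>_. ?N))" by (simp add: sC)
      have "vimage (fun_upd \<omega> n) {restrict c {0..<Suc n}} \<inter> configs =
          (if \<omega> = restrict c {0..<n} then {c n} else {})"
      proof -
        have "fun_upd \<omega> n x = restrict c {0..<Suc n} \<longleftrightarrow> x = c n \<and> \<omega> = restrict c {0..<n}" for x
        proof -
          have "\<omega> n = undefined" using w by (auto simp: space_PiM PiE_iff extensional_def)
          then show ?thesis by (auto simp: fun_eq_iff restrict_def less_Suc_eq)
        qed
        then show ?thesis using c[of n] by auto
      qed
      then show "emeasure (IT.eP n \<omega>) {restrict c {0..<Suc n}} =
          emeasure (P n (restrict c {0..<n})) {c n} * indicator {restrict c {0..<n}} \<omega>"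
        by (simp add: IT.emeasure_eP[OF w sS])
    qed
    also have "\<dots> = emeasure (P n (restrict c {0..<n})) {c n} * q n c"
      unfolding q_def by (rule nn_integral_cmult_indicator[OF sn])
    finally show ?thesis by (simp add: mult.commute)
  qed
  have q_0: "q 0 c = 1" for c
    using sing[of 0 c] by (simp add: q_def restrict_def)
  interpret L: prob_space ?L
  proof (rule prob_spaceI)
    show "emeasure ?L (space ?L) = 1" using L_q[of 0] q_0 by simp
  qed
  have step_L: "L.prob {\<omega> \<in> space ?L. \<omega> (Suc t) = C \<and> (\<forall>i\<le>t. \<omega> i = c i)} =
      L.prob {\<omega> \<in> space ?L. \<forall>i\<le>t. \<omega> i = c i} * pmf (step \<beta> p (c t)) C"
    if pos: "L.prob {\<omega> \<in> space ?L. \<forall>i\<le>t. \<omega> i = c i} > 0" for t c C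
  proof -
    have "{\<omega> \<in> space ?L. \<forall>i\<le>t. \<omega> i = c i} \<noteq> {}"
      using pos by (metis less_irrefl measure_empty)
    then obtain \<omega> where "\<omega> \<in> UNIV \<rightarrow> configs" "\<forall>i\<le>t. \<omega> i = c i"
      unfolding space_L by blast
    then have c: "c i \<in> configs" if "i \<le> t" for i
      using that by (metis Pi_mem UNIV_I)
    show ?thesis
    proof (cases "C \<in> configs")
      case False
      then have "{\<omega> \<in> space ?L. \<omega> (Suc t) = C \<and> (\<forall>i\<le>t. \<omega> i = c i)} = {}"
        unfolding space_L by auto
      moreover have "pmf (step \<beta> p (c t)) C = 0"
        using set_step[OF c, of t \<beta> p] False by (auto simp: pmf_eq_0_set_pmf)
      ultimately show ?thesis by (simp only: measure_empty mult_zero_right)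
    next
      case True
      define d where "d = c(Suc t := C)"
      have d: "i \<le> Suc t \<Longrightarrow> d i \<in> configs" for i
        using c True by (auto simp: d_def le_Suc_eq)
      have "{\<omega> \<in> space ?L. \<omega> (Suc t) = C \<and> (\<forall>i\<le>t. \<omega> i = c i)} = {\<omega> \<in> space ?L. \<forall>i<Suc (Suc t). \<omega> i = d i}"
        unfolding d_def by (auto simp: less_Suc_eq_le le_Suc_eq)
      then have "emeasure ?L {\<omega> \<in> space ?L. \<omega> (Suc t) = C \<and> (\<forall>i\<le>t. \<omega> i = c i)} = q (Suc (Suc t)) d"
        using L_q[of "Suc (Suc t)" d] d by (simp only: less_Suc_eq_le)
      also have "\<dots> = q (Suc t) d * emeasure (K (c t)) {C}"
        using q_Suc[of "Suc t" d] d by (simp add: P_def d_def)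
      also have "q (Suc t) d = emeasure ?L {\<omega> \<in> space ?L. \<forall>i<Suc t. \<omega> i = d i}"
        using L_q[of "Suc t" d] d by simp
      also have "{\<omega> \<in> space ?L. \<forall>i<Suc t. \<omega> i = d i} = {\<omega> \<in> space ?L. \<forall>i\<le>t. \<omega> i = c i}"
        unfolding d_def by (auto simp: less_Suc_eq_le)
      also have "emeasure (K (c t)) {C} = ennreal (pmf (step \<beta> p (c t)) C)"
        using em_K[of "{C}"] True by (simp add: emeasure_pmf_single)
      finally show ?thesis
        unfolding L.emeasure_eq_measure by (simp add: ennreal_mult[symmetric])
    qed
  qed
  have "exclusion_voter_process ?L \<beta> p (\<lambda>t \<omega>. \<omega> t)"
  proof
    show "\<beta> \<in> {0..1}" "p \<in> {0..1}" by (fact parameters)+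
    show "(\<lambda>\<omega>. \<omega> t) \<in> ?L \<rightarrow>\<^sub>M ?N" for t
      using measurable_component_singleton[of t UNIV "\<lambda>_. ?N"]
      by (simp add: measurable_cong_sets[OF IT.PF.sets_lim refl])
    show "\<P>(\<omega> in ?L. \<omega> (Suc t) = C \<bar> \<forall>i\<le>t. \<omega> i = c i) = pmf (step \<beta> p (c t)) C"
      if "L.prob {\<omega> \<in> space ?L. \<forall>i\<le>t. \<omega> i = c i} > 0" for t c C
      using step_L[OF that, of C] that by (simp add: cond_prob_def)
  qed
  moreover have "L.prob {\<omega> \<in> space ?L. \<omega> 0 = S\<^sub>0} = 1"
  proof -
    have "emeasure ?L {\<omega> \<in> space ?L. \<omega> 0 = S\<^sub>0} = q (Suc 0) (\<lambda>_. S\<^sub>0)"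
      using L_q[of "Suc 0" "\<lambda>_. S\<^sub>0"] S0 by simp
    also have "\<dots> = 1"
      using q_Suc[of 0 "\<lambda>_. S\<^sub>0"] S0 by (simp add: q_0 P_def)
    finally show ?thesis by (simp add: L.emeasure_eq_measure)
  qed
  ultimately show ?thesis by blast
qed

end

theory Submission
  imports Defs "HOL-Real_Asymp.Real_Asymp"
begin

text \<open>
  An exclusion move sorts a pair 01 with probability \<open>p > 1 / 2\<close> and reverses a pair 10 with the
  smaller probability \<open>1 - p\<close>. Each sorting move lowers an energy (essentially the number of inversions)
  by one, and for \<open>p < 1\<close> the dynamics is reversible with respect to the weight
  \<open>\<pi> S = card (unlike_pairs S) * r ^ energy S\<close> with \<open>r = (1 - p) / p < 1\<close>, which has finite total
  mass. Yet the energy is no Lyapunov function: the block configuration \<open>1\<dots>1 0\<dots>0 1\<dots>1 0\<dots>0\<close> has a single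
  pair 01 but two pairs 10, so that for \<open>p\<close> near \<open>1 / 2\<close> its number of inversions increases on average
  at first. The proof therefore works with square norms with respect to \<open>\<pi>\<close>.

  Let \<open>u t S\<close> (below: \<open>survival p t S\<close>) be the probability that the dynamics from \<open>S\<close> has
  not met an ordered configuration up to time \<open>t\<close>, an ordered configuration being one without pairs 01, that is, a translate of the
  ground state. A step does nothing with probability at least \<open>1 / 2\<close>, and for such a lazy chain the
  square norm \<open>\<Sum>S. \<pi> S * (u t S)\<^sup>2\<close> drops in each step by a constant multiple of the Dirichlet form of
  \<open>u t\<close> (lemma \<open>energy_dissipation\<close>). The Dirichlet form is bounded below by a Hardy inequality (lemma
  \<open>Hardy_inequality\<close>). Repeatedly swapping the leftmost pair 01 connects each configuration to an
  ordered one, where \<open>u t\<close> vanishes. These paths form a forest, and as configurations correspond to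
  partitions, with a box of the smallest part removed in each move, the generating function of
  the descendants of a configuration is bounded by that of all partitions, up to a geometric factor.
  Hence no edge is overloaded.

  The Hardy inequality bounds the sum \<open>\<Sum>S. r ^ energy S * (u t S)\<^sup>2\<close>, in which the number of unlike pairs
  is missing as a factor. Where this number is at most \<open>K\<close> the loss is a factor \<open>K\<close>, and the rest has
  exponentially small mass in \<open>K\<close>. With \<open>K\<close> of order \<open>sqrt t\<close> this gives a bound of the form
  \<open>A * exp (- c * sqrt t)\<close> for the square norm and so for \<open>u t S\<close> at each \<open>S\<close> (lemma
  \<open>survival_stretched_exponential\<close>). Such tails have moments of every order.

  Two choices keep the argument uniform. The sums run over all bi-infinite configurations instead of
  translation classes, since the weights remain summable and energy differences do not depend
  on the representative. And \<open>r\<close> is taken to be at least \<open>1 / 2\<close>; then \<open>\<pi>\<close> may cease to be invariant,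
  but mass can only be lost, and \<open>p = 1\<close>, where the reversible weight degenerates, is covered as well.
\<close>

section \<open>Configurations and adjacent swaps\<close>

definition swap_pair :: "(int \<Rightarrow> bool) \<Rightarrow> int \<Rightarrow> (int \<Rightarrow> bool)" where
  "swap_pair S x = S(x := S (x + 1), x + 1 := S x)"

definition inverted_pairs :: "(int \<Rightarrow> bool) \<Rightarrow> int set" where
  "inverted_pairs S = {x. \<not> S x \<and> S (x + 1)}"

definition ordered_pairs :: "(int \<Rightarrow> bool) \<Rightarrow> int set" where
  "ordered_pairs S = {x. S x \<and> \<not> S (x + 1)}"

lemma swap_pair_apply:
  "swap_pair S x y = (if y = x then S (x + 1) else if y = x + 1 then S x else S y)"
  by (simp add: swap_pair_def)

lemma swap_pair_swap_pair [simp]: "swap_pair (swap_pair S x) x = S"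
  by (simp add: swap_pair_def fun_eq_iff)

lemma swap_pair_pre_configs: "S \<in> pre_configs \<Longrightarrow> swap_pair S x \<in> pre_configs"
  unfolding swap_pair_def by (intro fun_upd_pre_configs)

lemma swap_pair_pre_configs_iff [simp]: "swap_pair S x \<in> pre_configs \<longleftrightarrow> S \<in> pre_configs"
  using swap_pair_pre_configs[of S x] swap_pair_pre_configs[of "swap_pair S x" x] by auto

lemma unlike_pairs_swap_pair [simp]: "x \<in> unlike_pairs (swap_pair S x) \<longleftrightarrow> x \<in> unlike_pairs S"
  by (auto simp: unlike_pairs_def swap_pair_apply)

lemma unlike_pairs_eq: "unlike_pairs S = inverted_pairs S \<union> ordered_pairs S"
  and inverted_ordered_disjoint: "inverted_pairs S \<inter> ordered_pairs S = {}"
  by (auto simp: unlike_pairs_def inverted_pairs_def ordered_pairs_def)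

lemma finite_inverted_pairs: "S \<in> pre_configs \<Longrightarrow> finite (inverted_pairs S)"
  and finite_ordered_pairs: "S \<in> pre_configs \<Longrightarrow> finite (ordered_pairs S)"
  using finite_unlike_pairs[of S] by (auto simp: unlike_pairs_eq)

text \<open>
  The label drops from 1 far to the left to 0 far to the right, so the drops outnumber the rises by
  exactly one.
\<close>

lemma card_ordered_pairs:
  assumes "S \<in> pre_configs"
  shows "card (ordered_pairs S) = Suc (card (inverted_pairs S))"
proof -
  obtain a b where ab: "a \<le> b" "\<And>x. x < a \<Longrightarrow> S x" "\<And>x. x > b \<Longrightarrow> \<not> S x"
    using pre_configs_cofinite[OF assms] by blast
  let ?h = "\<lambda>x. of_bool (S x) :: int"
  have telescope: "(\<Sum>x\<in>{a - 1..<a - 1 + int n}. ?h x - ?h (x + 1)) = ?h (a - 1) - ?h (a - 1 + int n)" for n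
  proof (induction n)
    case (Suc n)
    have "{a - 1..<a - 1 + int (Suc n)} = insert (a - 1 + int n) {a - 1..<a - 1 + int n}" by auto
    with Suc show ?case by (simp add: algebra_simps)
  qed simp
  let ?W = "{a - 1..<a - 1 + int (nat (b - a + 2))}"
  have W: "?W = {a - 1..b}" using ab(1) by auto
  have sub: "unlike_pairs S \<subseteq> {a - 1..b}"
  proof
    fix x assume x: "x \<in> unlike_pairs S"
    then have "\<not> (x + 1 < a)" "\<not> x > b" using ab(2)[of x] ab(2)[of "x+1"] ab(3)[of x] ab(3)[of "x+1"]
      by (auto simp: unlike_pairs_def)
    then show "x \<in> {a - 1..b}" by auto
  qed
  have "1 = (\<Sum>x\<in>?W. ?h x - ?h (x + 1))"
    unfolding telescope using ab(2)[of "a - 1"] ab(3)[of "b + 1"] ab(1) by (simp add: add.commute)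
  also have "\<dots> = (\<Sum>x\<in>unlike_pairs S. ?h x - ?h (x + 1))"
    unfolding W using sub by (intro sum.mono_neutral_right) (auto simp: unlike_pairs_def)
  also have "\<dots> = (\<Sum>x\<in>inverted_pairs S. -1) + (\<Sum>x\<in>ordered_pairs S. 1)"
    unfolding unlike_pairs_eq using assms
    by (subst sum.union_disjoint)
      (auto simp: finite_inverted_pairs finite_ordered_pairs inverted_ordered_disjoint
        intro!: sum.cong arg_cong2[where f = plus], auto simp: inverted_pairs_def ordered_pairs_def)
  finally show ?thesis by simp
qed

lemma card_unlike_pairs:
  assumes "S \<in> pre_configs"
  shows "card (unlike_pairs S) = 2 * card (inverted_pairs S) + 1"
  unfolding unlike_pairs_eq using assms
  by (subst card_Un_disjoint)
    (auto simp: finite_inverted_pairs finite_ordered_pairs inverted_ordered_disjoint card_ordered_pairs)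

definition defects :: "(int \<Rightarrow> bool) \<Rightarrow> int set" where
  "defects S = {x. S x \<noteq> (x < 0)}"

text \<open>
  For a configuration with as many 1's at nonnegative sites as 0's at negative ones this is the
  number of inversions, that is, of (not necessarily adjacent) pairs of sites with a 0 to the left
  of a 1. Written as a sum over defects it makes sense for every representative of a class, and a
  swap changes it in the same way for each of them.
\<close>

definition energy :: "(int \<Rightarrow> bool) \<Rightarrow> nat" where
  "energy S = (\<Sum>x\<in>defects S. nat \<bar>x\<bar>)"

lemma finite_defects:
  assumes "S \<in> pre_configs" shows "finite (defects S)"
proof -
  have "defects S \<subseteq> {x. x < 0 \<and> \<not> S x} \<union> {x. x > 0 \<and> S x} \<union> {0}"
    by (auto simp: defects_def)
  with assms show ?thesis by (auto simp: pre_configs_def elim: finite_subset)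
qed

text \<open>
  Away from the origin the swap moves a defect one site towards it. At the pair \<open>(-1, 0)\<close>
  it removes the two defects -1 and 0, of total size 1.
\<close>

lemma energy_swap_pair:
  assumes S: "S \<in> pre_configs" and x: "x \<in> inverted_pairs S"
  shows "energy S = Suc (energy (swap_pair S x))"
proof -
  let ?T = "swap_pair S x"
  let ?D = "defects S \<union> defects ?T - {x, x + 1}"
  have fin: "finite ?D" using S by (simp add: finite_defects)
  have energy: "energy R = of_bool (x \<in> defects R) * nat \<bar>x\<bar> + of_bool (x + 1 \<in> defects R) * nat \<bar>x + 1\<bar>
      + (\<Sum>y\<in>?D. of_bool (y \<in> defects R) * nat \<bar>y\<bar>)" if "R = S \<or> R = ?T" for R
  proof -
    have "energy R = (\<Sum>y\<in>insert x (insert (x + 1) ?D). of_bool (y \<in> defects R) * nat \<bar>y\<bar>)"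
      unfolding energy_def using fin that by (intro sum.mono_neutral_cong_left) auto
    then show ?thesis using fin by (simp add: add.assoc)
  qed
  have "(\<Sum>y\<in>?D. of_bool (y \<in> defects S) * nat \<bar>y\<bar>) = (\<Sum>y\<in>?D. of_bool (y \<in> defects ?T) * nat \<bar>y\<bar>)"
    by (intro sum.cong) (auto simp: defects_def swap_pair_apply)
  then show ?thesis
    using x energy[of S] energy[of ?T]
    by (auto simp: defects_def swap_pair_apply inverted_pairs_def of_bool_def split: if_splits)
qed

text \<open>
  Except for the pair \<open>(-1, 0)\<close>, an unlike pair contains a defect, and every defect other than 0
  contributes at least 1 to the energy. Configurations with many unlike pairs are therefore
  exponentially rare under weights of the form \<open>r ^ energy S\<close>.
\<close>

lemma card_unlike_pairs_le_energy:
  assumes S: "S \<in> pre_configs"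
  shows "card (unlike_pairs S) \<le> 2 * energy S + 3"
proof -
  note fin = finite_defects[OF S]
  have "unlike_pairs S \<subseteq> insert (- 1) (defects S \<union> (\<lambda>x. x - 1) ` defects S)"
  proof
    fix x assume "x \<in> unlike_pairs S"
    then have "x \<in> defects S \<or> x + 1 \<in> defects S \<or> x = - 1"
      by (auto simp: unlike_pairs_def defects_def)
    then show "x \<in> insert (- 1) (defects S \<union> (\<lambda>x. x - 1) ` defects S)" by force
  qed
  then have "card (unlike_pairs S) \<le> card (insert (- 1) (defects S \<union> (\<lambda>x. x - 1) ` defects S))"
    using fin by (intro card_mono) auto
  also have "\<dots> \<le> Suc (card (defects S \<union> (\<lambda>x. x - 1) ` defects S))"
    by (rule card_insert_le_m1) auto
  also have "\<dots> \<le> Suc (card (defects S) + card (defects S))"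
    using card_Un_le[of "defects S" "(\<lambda>x. x - 1) ` defects S"] card_image_le[OF fin, of "\<lambda>x. x - 1"] by simp
  also have "card (defects S) \<le> Suc (energy S)"
  proof -
    have "card (defects S - {0}) = (\<Sum>x\<in>defects S - {0}. 1)" by simp
    also have "\<dots> \<le> (\<Sum>x\<in>defects S - {0}. nat \<bar>x\<bar>)" by (intro sum_mono) auto
    also have "\<dots> \<le> energy S"
      unfolding energy_def using fin by (intro sum_mono2) auto
    finally show ?thesis using fin by (simp add: card_Diff_singleton_if split: if_splits)
  qed
  finally show ?thesis by simp
qed

lemma inj_defects: "inj defects"
  by (rule injI) (force simp: defects_def fun_eq_iff set_eq_iff)

lemma sum_power_abs_le:
  fixes r :: real
  assumes r: "0 \<le> r" "r < 1" and X: "finite X"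
  shows "(\<Sum>x\<in>X. r ^ nat \<bar>x::int\<bar>) \<le> 2 / (1 - r)"
proof -
  have half: "(\<Sum>x\<in>Y. r ^ nat \<bar>x\<bar>) \<le> 1 / (1 - r)" if "finite Y" "inj_on (\<lambda>x. nat \<bar>x\<bar>) Y" for Y :: "int set"
  proof -
    have "(\<Sum>x\<in>Y. r ^ nat \<bar>x\<bar>) = (\<Sum>n\<in>(\<lambda>x. nat \<bar>x\<bar>) ` Y. r ^ n)"
      using that by (simp add: sum.reindex)
    also have "\<dots> \<le> (\<Sum>n. r ^ n)"
      using r that by (intro sum_le_suminf summable_geometric) auto
    finally show ?thesis using r by (simp add: suminf_geometric)
  qed
  have "(\<Sum>x\<in>X. r ^ nat \<bar>x\<bar>) = (\<Sum>x\<in>X \<inter> {0..}. r ^ nat \<bar>x\<bar>) + (\<Sum>x\<in>X - {0..}. r ^ nat \<bar>x\<bar>)"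
    using X by (rule sum.Int_Diff)
  also have "\<dots> \<le> 1 / (1 - r) + 1 / (1 - r)"
    using X by (intro add_mono half) (auto simp: inj_on_def)
  finally show ?thesis by simp
qed

section \<open>Sums over all configurations\<close>

text \<open>
  A configuration is determined by its finite set of defects, so the sum over all configurations is
  the expansion of the product of \<open>1 + r ^ \<bar>x\<bar>\<close> over all sites \<open>x\<close>. Translates of one another are
  summed as different configurations; the product still converges.
\<close>

lemma nn_integral_power_energy_finite:
  fixes r :: real
  assumes r: "0 \<le> r" "r < 1"
  shows "(\<integral>\<^sup>+S. ennreal (r ^ energy S) \<partial>count_space pre_configs) < \<infinity>"
proof -
  define A where "A n = {S. defects S \<subseteq> {- int n..int n}}" for n
  have fin: "finite (A n)" for n
  proof -
    have "A n \<subseteq> defects -` Pow {- int n..int n}" by (auto simp: A_def)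
    then show ?thesis
      using finite_vimageI[OF _ inj_defects, of "Pow {- int n..int n}"] finite_subset by blast
  qed
  have A_pre: "A n \<subseteq> pre_configs" for n
  proof
    fix S assume "S \<in> A n"
    then have window: "x \<in> {- int n..int n}" if "S x \<noteq> (x < 0)" for x
      using that by (auto simp: A_def defects_def)
    show "S \<in> pre_configs"
    proof (rule pre_configsI[of "- int n" _ "int n"])
      show "S x" if "x < - int n" for x using window[of x] that by auto
      show "\<not> S x" if "x > int n" for x using window[of x] that by auto
    qed
  qed
  have exhaust: "\<exists>n. S \<in> A n" if "S \<in> pre_configs" for S
  proof -
    have "\<bar>x\<bar> \<le> (\<Sum>y\<in>defects S. \<bar>y\<bar>)" if "x \<in> defects S" for x
      using that finite_defects[OF \<open>S \<in> pre_configs\<close>] by (intro member_le_sum) auto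
    then have "S \<in> A (nat (\<Sum>y\<in>defects S. \<bar>y\<bar>))" by (force simp: A_def)
    then show ?thesis ..
  qed
  have bound: "(\<Sum>S\<in>A n. r ^ energy S) \<le> exp (2 / (1 - r))" for n
  proof -
    have "(\<Sum>S\<in>A n. r ^ energy S) = (\<Sum>S\<in>A n. \<Prod>x\<in>defects S. r ^ nat \<bar>x\<bar>)"
      by (simp add: energy_def power_sum)
    also have "\<dots> = (\<Sum>X\<in>defects ` A n. \<Prod>x\<in>X. r ^ nat \<bar>x\<bar>)"
      using inj_defects by (subst sum.reindex) (auto simp: inj_on_def)
    also have "\<dots> \<le> (\<Sum>X\<in>Pow {- int n..int n}. \<Prod>x\<in>X. r ^ nat \<bar>x\<bar>)"
      using r by (intro sum_mono2) (auto simp: A_def intro!: prod_nonneg)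
    also have "\<dots> = (\<Prod>x\<in>{- int n..int n}. r ^ nat \<bar>x\<bar> + 1)"
      by (subst prod_add) auto
    also have "\<dots> \<le> (\<Prod>x\<in>{- int n..int n}. exp (r ^ nat \<bar>x\<bar>))"
      using r by (intro prod_mono) (auto simp: add.commute)
    also have "\<dots> = exp (\<Sum>x\<in>{- int n..int n}. r ^ nat \<bar>x\<bar>)"
      by (simp add: exp_sum)
    also have "\<dots> \<le> exp (2 / (1 - r))" using sum_power_abs_le[OF r] by simp
    finally show ?thesis .
  qed
  have "(\<integral>\<^sup>+S. ennreal (r ^ energy S) \<partial>count_space pre_configs) =
      (\<integral>\<^sup>+S. (SUP n. ennreal (r ^ energy S) * indicator (A n) S) \<partial>count_space pre_configs)"
  proof (rule nn_integral_cong)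
    fix S assume "S \<in> space (count_space pre_configs)"
    then obtain n where n: "S \<in> A n" using exhaust by auto
    show "ennreal (r ^ energy S) = (SUP n. ennreal (r ^ energy S) * indicator (A n) S)"
      by (rule antisym, rule SUP_upper2[of n]) (use n in \<open>auto intro!: SUP_least split: split_indicator\<close>)
  qed
  also have "\<dots> = (SUP n. \<integral>\<^sup>+S. ennreal (r ^ energy S) * indicator (A n) S \<partial>count_space pre_configs)"
  proof (rule nn_integral_monotone_convergence_SUP)
    have "A m \<subseteq> A n" if "m \<le> n" for m n
      using that by (force simp: A_def)
    then show "incseq (\<lambda>n S. ennreal (r ^ energy S) * indicator (A n) S)"
      by (intro monoI le_funI mult_left_mono) (auto split: split_indicator)
  qed simp
  also have "\<dots> \<le> ennreal (exp (2 / (1 - r)))"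
  proof (rule SUP_least)
    fix n
    have "(\<integral>\<^sup>+S. ennreal (r ^ energy S) * indicator (A n) S \<partial>count_space pre_configs) =
        (\<Sum>S\<in>A n. ennreal (r ^ energy S))"
      using fin[of n] A_pre[of n] by (subst nn_integral_count_space'[of "A n"]) auto
    also have "\<dots> = ennreal (\<Sum>S\<in>A n. r ^ energy S)" using r by (simp add: sum_ennreal)
    also have "\<dots> \<le> ennreal (exp (2 / (1 - r)))" by (rule ennreal_leI[OF bound])
    finally show "(\<integral>\<^sup>+S. ennreal (r ^ energy S) * indicator (A n) S \<partial>count_space pre_configs)
        \<le> ennreal (exp (2 / (1 - r)))" .
  qed
  finally show ?thesis by (rule le_less_trans) simp
qed

text \<open>
  Mass transport: for each \<open>x\<close>, swapping at \<open>x\<close> is an involution of the set of configurations that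
  preserves unlikeness of the pair at \<open>x\<close>. Summed over all configurations, flows into them therefore
  equal flows out of them.
\<close>

lemma nn_integral_sum_unlike_pairs_swap_pair:
  fixes F :: "(int \<Rightarrow> bool) \<Rightarrow> int \<Rightarrow> ennreal"
  shows "(\<integral>\<^sup>+S. (\<Sum>x\<in>unlike_pairs S. F (swap_pair S x) x) \<partial>count_space pre_configs) =
    (\<integral>\<^sup>+S. (\<Sum>x\<in>unlike_pairs S. F S x) \<partial>count_space pre_configs)"
proof -
  let ?i = "\<lambda>S x. indicator (unlike_pairs S) x :: ennreal"
  have expand: "(\<integral>\<^sup>+S. (\<Sum>x\<in>unlike_pairs S. G S x) \<partial>count_space pre_configs) =
      (\<integral>\<^sup>+x. (\<integral>\<^sup>+S. G S x * ?i S x \<partial>count_space pre_configs) \<partial>count_space UNIV)"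
    for G :: "(int \<Rightarrow> bool) \<Rightarrow> int \<Rightarrow> ennreal"
  proof -
    have "(\<integral>\<^sup>+S. (\<Sum>x\<in>unlike_pairs S. G S x) \<partial>count_space pre_configs) =
        (\<integral>\<^sup>+S. (\<integral>\<^sup>+x. G S x * ?i S x \<partial>count_space UNIV) \<partial>count_space pre_configs)"
    proof (rule nn_integral_cong)
      fix S assume "S \<in> space (count_space pre_configs)"
      then show "(\<Sum>x\<in>unlike_pairs S. G S x) = (\<integral>\<^sup>+x. G S x * ?i S x \<partial>count_space UNIV)"
        using finite_unlike_pairs[of S] by (subst nn_integral_count_space'[of "unlike_pairs S"]) auto
    qed
    also have "\<dots> = (\<integral>\<^sup>+x. (\<integral>\<^sup>+S. G S x * ?i S x \<partial>count_space pre_configs) \<partial>count_space UNIV)"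
      by (intro nn_integral_count_space_nn_integral) auto
    finally show ?thesis .
  qed
  have "(\<integral>\<^sup>+S. F (swap_pair S x) x * ?i S x \<partial>count_space pre_configs) =
      (\<integral>\<^sup>+S. F S x * ?i S x \<partial>count_space pre_configs)" for x
  proof -
    have "bij_betw (\<lambda>S. swap_pair S x) pre_configs pre_configs"
      by (rule bij_betwI[where g = "\<lambda>S. swap_pair S x"]) auto
    from nn_integral_bij_count_space[OF this, of "\<lambda>S. F S x * ?i S x"]
    show ?thesis by (simp add: indicator_def)
  qed
  then show ?thesis by (simp add: expand)
qed

definition config_integral :: "((int \<Rightarrow> bool) \<Rightarrow> real) \<Rightarrow> ennreal" where
  "config_integral g = (\<integral>\<^sup>+S. ennreal (g S) \<partial>count_space pre_configs)"

lemma config_integral_mono: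
  "(\<And>S. S \<in> pre_configs \<Longrightarrow> f S \<le> g S) \<Longrightarrow> config_integral f \<le> config_integral g"
  unfolding config_integral_def by (intro nn_integral_mono ennreal_leI) simp

lemma config_integral_cong:
  "(\<And>S. S \<in> pre_configs \<Longrightarrow> f S = g S) \<Longrightarrow> config_integral f = config_integral g"
  unfolding config_integral_def by (intro nn_integral_cong) simp

lemma config_integral_add:
  assumes "\<And>S. S \<in> pre_configs \<Longrightarrow> 0 \<le> f S" "\<And>S. S \<in> pre_configs \<Longrightarrow> 0 \<le> g S"
  shows "config_integral (\<lambda>S. f S + g S) = config_integral f + config_integral g"
proof -
  have "config_integral (\<lambda>S. f S + g S) = (\<integral>\<^sup>+S. ennreal (f S) + ennreal (g S) \<partial>count_space pre_configs)"
    unfolding config_integral_def using assms by (intro nn_integral_cong) simp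
  then show ?thesis by (simp add: config_integral_def nn_integral_add)
qed

lemma config_integral_cmult:
  "0 \<le> c \<Longrightarrow> (\<And>S. 0 \<le> f S) \<Longrightarrow> config_integral (\<lambda>S. c * f S) = ennreal c * config_integral f"
  unfolding config_integral_def by (simp add: ennreal_mult nn_integral_cmult)

lemma config_integral_swap_pair:
  assumes "\<And>S x. 0 \<le> F S x"
  shows "config_integral (\<lambda>S. \<Sum>x\<in>unlike_pairs S. F (swap_pair S x) x) =
    config_integral (\<lambda>S. \<Sum>x\<in>unlike_pairs S. F S x)"
  using nn_integral_sum_unlike_pairs_swap_pair[of "\<lambda>S x. ennreal (F S x)"] assms
  by (simp add: config_integral_def sum_ennreal)

section \<open>A Hardy inequality along the tree of leftmost swaps\<close>

text \<open>
  The generating function \<open>\<Sum> q ^ |\<lambda>|\<close> of the partitions \<open>\<lambda>\<close> with all parts at most \<open>n\<close>, in Euler's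
  product form.
\<close>

definition partition_weight :: "real \<Rightarrow> nat \<Rightarrow> real" where
  "partition_weight q n = (\<Prod>j<n. 1 / (1 - q ^ Suc j))"

lemma partition_weight_ge_1:
  assumes "0 \<le> q" "q < 1" shows "1 \<le> partition_weight q n"
  unfolding partition_weight_def
proof (rule prod_ge_1)
  fix j have "q ^ Suc j < 1" using assms by (intro power_less_one_iff[THEN iffD2]) auto
  then show "1 \<le> 1 / (1 - q ^ Suc j)" using assms by simp
qed

text \<open>
  Partitions are sorted by their largest part \<open>Suc i\<close>; the empty one contributes 1.
\<close>

lemma partition_weight_rec:
  assumes "0 \<le> q" "q < 1"
  shows "partition_weight q m = 1 + (\<Sum>i<m. q ^ Suc i * partition_weight q (Suc i))"
proof (induction m)
  case (Suc m)
  have "q ^ Suc m < 1" using assms by (intro power_less_one_iff[THEN iffD2]) auto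
  then have "partition_weight q (Suc m) * (1 - q ^ Suc m) = partition_weight q m"
    by (simp add: partition_weight_def)
  with Suc show ?case by (simp add: algebra_simps)
qed (simp add: partition_weight_def)

lemma partition_weight_le:
  assumes q: "0 \<le> q" "q < 1"
  shows "partition_weight q n \<le> exp (1 / (1 - q)\<^sup>2)"
proof -
  have "partition_weight q n \<le> (\<Prod>j<n. exp (q ^ j / (1 - q)))"
    unfolding partition_weight_def
  proof (intro prod_mono conjI)
    fix j
    have l: "q ^ Suc j \<le> q" "q ^ Suc j \<le> q ^ j"
      using q power_decreasing[of 1 "Suc j" q] power_decreasing[of j "Suc j" q] by auto
    then show "0 \<le> 1 / (1 - q ^ Suc j)" using q by auto
    have "1 / (1 - q ^ Suc j) = 1 + q ^ Suc j / (1 - q ^ Suc j)"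
      using l q by (simp add: field_simps)
    also have "\<dots> \<le> 1 + q ^ j / (1 - q)"
      using l q by (intro add_mono frac_le) auto
    also have "\<dots> \<le> exp (q ^ j / (1 - q))" by simp
    finally show "1 / (1 - q ^ Suc j) \<le> exp (q ^ j / (1 - q))" .
  qed
  also have "\<dots> = exp ((\<Sum>j<n. q ^ j) / (1 - q))"
    by (simp add: exp_sum sum_divide_distrib)
  also have "\<dots> \<le> exp (1 / (1 - q) / (1 - q))"
  proof -
    have "(\<Sum>j<n. q ^ j) \<le> (\<Sum>j. q ^ j)"
      using q by (intro sum_le_suminf summable_geometric) auto
    also have "\<dots> = 1 / (1 - q)" using q by (simp add: suminf_geometric)
    finally have "(\<Sum>j<n. q ^ j) / (1 - q) \<le> 1 / (1 - q) / (1 - q)"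
      using q by (intro divide_right_mono) auto
    then show ?thesis by (rule exp_le_cancel_iff[THEN iffD2])
  qed
  finally show ?thesis by (simp add: power2_eq_square)
qed

text \<open>
  The configuration reads \<open>\<dots>111\<close> up to \<open>a - 1\<close>, then exactly \<open>m\<close> zeros, then a 1. Its leftmost
  pair 01 is thus at \<open>a + m - 1\<close>. In terms of the partition whose parts count, for each displaced 1,
  the 0's to its left, \<open>m\<close> is the smallest part.
\<close>

definition leading_run :: "(int \<Rightarrow> bool) \<Rightarrow> int \<Rightarrow> nat \<Rightarrow> bool" where
  "leading_run S a m \<longleftrightarrow>
     0 < m \<and> (\<forall>x<a. S x) \<and> (\<forall>x\<in>{a..<a + int m}. \<not> S x) \<and> S (a + int m)"

definition the_leading_run :: "(int \<Rightarrow> bool) \<Rightarrow> int \<times> nat" where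
  "the_leading_run S = (SOME (a, m). leading_run S a m)"

lemma leading_run_unique:
  assumes 1: "leading_run S a m" and 2: "leading_run S b n"
  shows "a = b \<and> m = n"
proof -
  have "\<not> a < b" "\<not> b < a" using 1 2 unfolding leading_run_def by force+
  then have "a = b" by simp
  moreover have "\<not> m < n" "\<not> n < m"
    using 1 2 \<open>a = b\<close> unfolding leading_run_def by force+
  ultimately show ?thesis by simp
qed

lemma the_leading_run_eq: "leading_run S a m \<Longrightarrow> the_leading_run S = (a, m)"
  unfolding the_leading_run_def
  by (rule some_equality) (auto dest: leading_run_unique)

lemma leading_run_exists:
  assumes S: "S \<in> pre_configs" and inv: "inverted_pairs S \<noteq> {}"
  obtains a m where "leading_run S a m"
proof -
  obtain c where c: "\<And>x. x < c \<Longrightarrow> S x"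
    using pre_configs_cofinite[OF S] by metis
  from inv obtain x where x: "\<not> S x" "S (x + 1)" by (auto simp: inverted_pairs_def)
  have "c \<le> x" using c[of x] x by force
  define i where "i = (LEAST i. \<not> S (c + int i))"
  have i: "\<not> S (c + int i)" "\<And>j. j < i \<Longrightarrow> S (c + int j)" "i \<le> nat (x - c)"
  proof -
    have w: "\<not> S (c + int (nat (x - c)))" using x \<open>c \<le> x\<close> by simp
    show "\<not> S (c + int i)" unfolding i_def by (rule LeastI[of "\<lambda>i. \<not> S (c + int i)", OF w])
    show "i \<le> nat (x - c)" unfolding i_def by (rule Least_le[of "\<lambda>i. \<not> S (c + int i)", OF w])
    show "S (c + int j)" if "j < i" for j
      using not_less_Least[of j "\<lambda>i. \<not> S (c + int i)"] that unfolding i_def by blast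
  qed
  define a where "a = c + int i"
  define m where "m = (LEAST m. S (a + int m))"
  have a: "a \<le> x" using i(3) \<open>c \<le> x\<close> by (simp add: a_def)
  have m: "S (a + int m)" "\<And>j. j < m \<Longrightarrow> \<not> S (a + int j)"
  proof -
    have w: "S (a + int (nat (x + 1 - a)))" using x a by simp
    show "S (a + int m)" unfolding m_def by (rule LeastI[of "\<lambda>i. S (a + int i)", OF w])
    show "\<not> S (a + int j)" if "j < m" for j
      using not_less_Least[of j "\<lambda>i. S (a + int i)"] that unfolding m_def by blast
  qed
  have "leading_run S a m"
    unfolding leading_run_def
  proof (intro conjI allI ballI impI)
    show "0 < m" using m i by (auto simp: a_def intro: ccontr)
    show "S y" if "y < a" for y
      using c[of y] i(2)[of "nat (y - c)"] that by (cases "y < c") (auto simp: a_def)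
    show "\<not> S y" if "y \<in> {a..<a + int m}" for y
    proof -
      have "nat (y - a) < m" using that by auto
      then show ?thesis using m(2)[of "nat (y - a)"] that by simp
    qed
  qed (rule m)
  then show thesis by (rule that)
qed

lemma leading_run_imp_inverted:
  "leading_run S a m \<Longrightarrow> a + int m - 1 \<in> inverted_pairs S"
  by (auto simp: leading_run_def inverted_pairs_def)

definition leftmost_inverted :: "(int \<Rightarrow> bool) \<Rightarrow> int" where
  "leftmost_inverted S = (case the_leading_run S of (a, m) \<Rightarrow> a + int m - 1)"

text \<open>
  Swapping the leftmost pair 01 turns the configurations into a forest, with the ordered
  configurations as roots; in terms of partitions a box is removed from the smallest part.
  The weight is the generating function of the descendants of \<open>S\<close> by generation. A descendant arises
  by enlarging the smallest part \<open>m\<close> to some \<open>m + i\<close>, which is possible as long as the displaced 1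
  meets only 0's on its way, and then appending a partition with parts at most \<open>m + i\<close>.
  The decisive point is that this weight is bounded uniformly in \<open>S\<close>.
\<close>

definition tree_weight :: "real \<Rightarrow> (int \<Rightarrow> bool) \<Rightarrow> real" where
  "tree_weight q S = (case the_leading_run S of (a, m) \<Rightarrow>
     (\<Sum>i. q ^ i * partition_weight q (m + i) *
        of_bool (\<forall>y\<in>{a + int m<..a + int m + int i}. \<not> S y)))"

definition children :: "(int \<Rightarrow> bool) \<Rightarrow> int set" where
  "children T = {x \<in> unlike_pairs T. inverted_pairs (swap_pair T x) \<noteq> {} \<and>
     leftmost_inverted (swap_pair T x) = x}"

lemma summable_tree_weight:
  assumes q: "0 \<le> q" "q < 1"
  shows "summable (\<lambda>i. q ^ i * partition_weight q (m + i) * of_bool (P i))"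
proof (rule summable_comparison_test')
  show "summable (\<lambda>i. exp (1 / (1 - q)\<^sup>2) * q ^ i)"
    using q by (intro summable_mult summable_geometric) auto
  show "norm (q ^ i * partition_weight q (m + i) * of_bool (P i)) \<le> exp (1 / (1 - q)\<^sup>2) * q ^ i" for i
    using partition_weight_le[OF q, of "m + i"] partition_weight_ge_1[OF q, of "m + i"] q
    by (auto simp: abs_mult mult.commute intro!: mult_left_mono)
qed

lemma tree_weight_bounds:
  assumes q: "0 \<le> q" "q < 1"
  shows "0 \<le> tree_weight q S" "tree_weight q S \<le> exp (1 / (1 - q)\<^sup>2) / (1 - q)"
proof -
  obtain a m where am: "the_leading_run S = (a, m)" by fastforce
  let ?P = "\<lambda>i. \<forall>y\<in>{a + int m<..a + int m + int i}. \<not> S y"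
  note p = partition_weight_ge_1[OF q] partition_weight_le[OF q]
  have p0: "0 \<le> partition_weight q n" for n using p(1)[of n] by linarith
  show "0 \<le> tree_weight q S"
    unfolding tree_weight_def am prod.case
    using q p0 by (intro suminf_nonneg summable_tree_weight) auto
  have "tree_weight q S \<le> (\<Sum>i. exp (1 / (1 - q)\<^sup>2) * q ^ i)"
    unfolding tree_weight_def am prod.case
    using q p0 p(2)
    by (intro suminf_le summable_tree_weight summable_mult summable_geometric)
      (auto simp: mult.commute intro!: mult_left_mono)
  also have "\<dots> = exp (1 / (1 - q)\<^sup>2) / (1 - q)"
    using q by (simp add: suminf_mult summable_geometric suminf_geometric)
  finally show "tree_weight q S \<le> exp (1 / (1 - q)\<^sup>2) / (1 - q)" .
qed

lemma leading_run_left_child: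
  assumes "leading_run T a m" shows "leading_run (swap_pair T (a - 1)) (a - 1) 1"
  using assms by (auto simp: leading_run_def swap_pair_apply)

lemma leading_run_right_child:
  assumes "leading_run T a m" "\<not> T (a + int m + 1)"
  shows "leading_run (swap_pair T (a + int m)) a (Suc m)"
  using assms by (auto simp: leading_run_def swap_pair_apply)

text \<open>
  In a child of \<open>T\<close> the swapped pair 01 is the leftmost one. If its leading run has length 1, the swap
  has moved the last 1 of the initial block; otherwise it has moved the first displaced 1 of \<open>T\<close> one
  site to the right.
\<close>

lemma children_cases:
  assumes T: "T \<in> pre_configs" and run: "leading_run T a m" and x: "x \<in> children T"
  shows "x = a - 1 \<or> x = a + int m \<and> \<not> T (a + int m + 1)"
proof -
  let ?S = "swap_pair T x"
  obtain b n where S: "leading_run ?S b n"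
    using leading_run_exists[of ?S] T x by (auto simp: children_def)
  then have x_eq: "x = b + int n - 1"
    using x by (simp add: children_def leftmost_inverted_def the_leading_run_eq)
  have T_eq: "T y = (if y = x then ?S (x + 1) else if y = x + 1 then ?S x else ?S y)" for y
    using swap_pair_swap_pair[of T x] swap_pair_apply[of ?S x y] by simp
  show ?thesis
  proof (cases "n = 1")
    case True
    have below: "T y" if "y < b + 1" for y
      using S x_eq that True T_eq[of y] by (auto simp: leading_run_def)
    have "\<not> T (b + 1)"
      using S x_eq True T_eq[of "b + 1"] by (auto simp: leading_run_def)
    have "a = b + 1"
    proof (rule antisym)
      show "a \<le> b + 1" using \<open>\<not> T (b + 1)\<close> run by (force simp: leading_run_def)
      have "\<not> T a" using run by (auto simp: leading_run_def)
      then show "b + 1 \<le> a" using below[of a] by force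
    qed
    then show ?thesis using x_eq True by simp
  next
    case False
    then have "leading_run T b (n - 1)"
      using S x_eq T_eq by (auto simp: leading_run_def of_nat_diff)
    with run have "a = b" "m = n - 1" by (auto dest: leading_run_unique)
    moreover have "0 < n" "\<not> ?S x" using S x_eq by (auto simp: leading_run_def)
    ultimately show ?thesis
      using x_eq T_eq[of "x + 1"] by (auto simp: of_nat_diff)
  qed
qed

text \<open>
  The generating function of the descendants splits into the configuration itself and the descendants
  of its children: the term \<open>i = 0\<close> of the weight accounts for the left child, through the recursion
  of \<^const>\<open>partition_weight\<close>, and the terms with \<open>i > 0\<close> for the right child.
\<close>

lemma tree_weight_children:
  assumes q: "0 \<le> q" "q < 1" and T: "T \<in> pre_configs" and run: "leading_run T a m"
  shows "1 + q * (\<Sum>x\<in>children T. tree_weight q (swap_pair T x)) \<le> tree_weight q T"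
proof -
  let ?R = "if T (a + int m + 1) then {} else {a + int m}"
  have m: "0 < m" using run by (simp add: leading_run_def)
  have sub: "children T \<subseteq> insert (a - 1) ?R"
    using children_cases[OF T run] by auto
  have "(\<Sum>x\<in>children T. tree_weight q (swap_pair T x)) \<le>
      (\<Sum>x\<in>insert (a - 1) ?R. tree_weight q (swap_pair T x))"
    using sub tree_weight_bounds[OF q] by (intro sum_mono2) auto
  also have "\<dots> = tree_weight q (swap_pair T (a - 1)) + (\<Sum>x\<in>?R. tree_weight q (swap_pair T x))"
    by (subst sum.insert) auto
  finally have le: "(\<Sum>x\<in>children T. tree_weight q (swap_pair T x)) \<le> \<dots>" .
  have left: "q * tree_weight q (swap_pair T (a - 1)) = partition_weight q m - 1"
  proof -
    have gap: "(\<forall>y\<in>{a - 1 + int 1<..a - 1 + int 1 + int i}. \<not> swap_pair T (a - 1) y) \<longleftrightarrow> i < m" for i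
    proof
      assume empty: "\<forall>y\<in>{a - 1 + int 1<..a - 1 + int 1 + int i}. \<not> swap_pair T (a - 1) y"
      show "i < m"
      proof (rule ccontr)
        assume "\<not> i < m"
        then have "\<not> swap_pair T (a - 1) (a + int m)" using empty m by simp
        then show False using run m by (simp add: leading_run_def swap_pair_apply)
      qed
    next
      assume "i < m" then show "\<forall>y\<in>{a - 1 + int 1<..a - 1 + int 1 + int i}. \<not> swap_pair T (a - 1) y"
        using run by (auto simp: leading_run_def swap_pair_apply)
    qed
    have "tree_weight q (swap_pair T (a - 1)) =
        (\<Sum>i. q ^ i * partition_weight q (1 + i) * of_bool (i < m))"
      unfolding tree_weight_def the_leading_run_eq[OF leading_run_left_child[OF run]] prod.case gap ..
    also have "\<dots> = (\<Sum>i<m. q ^ i * partition_weight q (Suc i))"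
      by (subst suminf_finite[of "{..<m}"]) auto
    finally show ?thesis
      by (simp add: partition_weight_rec[OF q, of m] sum_distrib_left mult.assoc)
  qed
  let ?P = "\<lambda>i. \<forall>y\<in>{a + int m<..a + int m + int i}. \<not> T y"
  have split: "tree_weight q T = partition_weight q m +
      (\<Sum>i. q ^ Suc i * partition_weight q (m + Suc i) * of_bool (?P (Suc i)))"
    unfolding tree_weight_def the_leading_run_eq[OF run] prod.case
    using suminf_split_head[OF summable_tree_weight[OF q], of m ?P] by simp
  have right: "q * (\<Sum>x\<in>?R. tree_weight q (swap_pair T x)) =
      (\<Sum>i. q ^ Suc i * partition_weight q (m + Suc i) * of_bool (?P (Suc i)))"
  proof (cases "T (a + int m + 1)")
    case True
    then have "\<not> ?P (Suc i)" for i by (auto intro!: bexI[of _ "a + int m + 1"])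
    then have none: "of_bool (?P (Suc i)) = (0 :: real)" for i by (simp only: of_bool_eq simp_thms)
    show ?thesis unfolding none using True by simp
  next
    case False
    have gap: "(\<forall>y\<in>{a + int (Suc m)<..a + int (Suc m) + int i}. \<not> swap_pair T (a + int m) y) \<longleftrightarrow> ?P (Suc i)" for i
    proof -
      have "{a + int m<..a + int m + int (Suc i)} =
          insert (a + int m + 1) {a + int (Suc m)<..a + int (Suc m) + int i}" by auto
      then show ?thesis using False by (auto simp: swap_pair_apply)
    qed
    have "tree_weight q (swap_pair T (a + int m)) =
        (\<Sum>i. q ^ i * partition_weight q (Suc m + i) * of_bool (?P (Suc i)))"
      unfolding tree_weight_def the_leading_run_eq[OF leading_run_right_child[OF run False]] prod.case gap ..
    then have "q * tree_weight q (swap_pair T (a + int m)) =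
        (\<Sum>i. q * (q ^ i * partition_weight q (Suc m + i) * of_bool (?P (Suc i))))"
      by (simp only: suminf_mult[OF summable_tree_weight[OF q]])
    then show ?thesis using False by (simp add: mult.assoc)
  qed
  have "1 + q * (\<Sum>x\<in>children T. tree_weight q (swap_pair T x)) \<le>
      1 + q * (tree_weight q (swap_pair T (a - 1)) + (\<Sum>x\<in>?R. tree_weight q (swap_pair T x)))"
    using le q by (intro add_left_mono mult_left_mono) auto
  also have "\<dots> = tree_weight q T"
    unfolding distrib_left left right split by simp
  finally show ?thesis .
qed

lemma square_le_weighted_squares:
  fixes a b r q :: real
  assumes "0 < r" "r < q"
  shows "a\<^sup>2 \<le> q / r * b\<^sup>2 + q / (q - r) * (a - b)\<^sup>2"
proof -
  have "0 \<le> ((q - r) * b - r * (a - b))\<^sup>2 / (r * (q - r))"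
    using assms by simp
  also have "\<dots> = q / r * b\<^sup>2 + q / (q - r) * (a - b)\<^sup>2 - a\<^sup>2"
    using assms by (simp add: divide_simps) (simp add: algebra_simps power2_eq_square)
  finally show ?thesis by simp
qed

text \<open>
  A spectral gap for the weight \<open>r ^ energy S\<close>. The value \<open>f S\<close> is compared with the value at the
  parent of \<open>S\<close>, at the price of a factor \<open>q / r > 1\<close>. Since a child has \<open>r\<close> times the weight of its
  parent, summing with the additional weight \<open>tree_weight q\<close> lets the parents absorb all but
  the amount \<open>r ^ energy S * (f S)\<^sup>2\<close> at each \<open>S\<close>; at the roots \<open>f\<close> vanishes, which stops the
  iteration. What is left over is bounded by the differences along the edges.
\<close>

lemma Hardy_inequality:
  fixes r :: real
  assumes r: "0 < r" "r < 1"
  obtains C where "0 < C"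
    "\<And>f :: (int \<Rightarrow> bool) \<Rightarrow> real. (\<And>S. \<bar>f S\<bar> \<le> 1) \<Longrightarrow>
      (\<And>S. inverted_pairs S = {} \<Longrightarrow> f S = 0) \<Longrightarrow>
      config_integral (\<lambda>S. r ^ energy S * (f S)\<^sup>2) \<le>
      ennreal C * config_integral (\<lambda>S. r ^ energy S *
        (\<Sum>x\<in>inverted_pairs S. (f S - f (swap_pair S x))\<^sup>2))"
proof -
  \<comment> \<open>room between \<open>r\<close> and 1 for the factor \<open>q / r\<close> lost in passing to the parent\<close>
  define q where "q = (1 + r) / 2"
  have q: "r < q" "0 \<le> q" "q < 1" using r by (auto simp: q_def)
  define V where "V = exp (1 / (1 - q)\<^sup>2) / (1 - q)"
  define v where "v = tree_weight q"
  have V: "0 < V" using q by (simp add: V_def)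
  have v: "0 \<le> v S" "v S \<le> V" for S
    using tree_weight_bounds[OF q(2,3), of S] by (auto simp: v_def V_def)
  define C where "C = V * (q / (q - r))"
  have C: "0 < C" using V q r by (simp add: C_def)
  show thesis
  proof (rule that[OF C])
    fix f :: "(int \<Rightarrow> bool) \<Rightarrow> real"
    assume f1: "\<And>S. \<bar>f S\<bar> \<le> 1" and f0: "\<And>S. inverted_pairs S = {} \<Longrightarrow> f S = 0"
    let ?I = config_integral
    define \<mu> where "\<mu> S = r ^ energy S" for S
    define D where "D S = (\<Sum>x\<in>inverted_pairs S. (f S - f (swap_pair S x))\<^sup>2)" for S
    \<comment> \<open>written as a sum over all unlike pairs, with at most one nonzero summand, to fit mass transport\<close>
    define parent_term where
      "parent_term S = (\<Sum>x\<in>unlike_pairs S. of_bool (inverted_pairs S \<noteq> {} \<and> leftmost_inverted S = x) *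
          (q / r * \<mu> S * v S * (f (swap_pair S x))\<^sup>2))" for S
    have \<mu>: "0 < \<mu> S" for S using r by (simp add: \<mu>_def)
    have D0: "0 \<le> D S" for S by (auto simp: D_def intro: sum_nonneg)
    have pt0: "0 \<le> parent_term S" for S
      using q r \<mu> v by (auto simp: parent_term_def less_imp_le intro!: sum_nonneg mult_nonneg_nonneg)
    have step: "\<mu> S * v S * (f S)\<^sup>2 \<le> parent_term S + C * (\<mu> S * D S)" if S: "S \<in> pre_configs" for S
    proof (cases "inverted_pairs S = {}")
      case True
      then show ?thesis using f0 pt0 C \<mu> D0 by (simp add: less_imp_le)
    next
      case False
      let ?x = "leftmost_inverted S"
      obtain a m where am: "leading_run S a m" using leading_run_exists[OF S False] .
      then have x: "?x \<in> inverted_pairs S"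
        using leading_run_imp_inverted by (simp add: leftmost_inverted_def the_leading_run_eq)
      have "parent_term S = (\<Sum>x\<in>{?x}. of_bool (inverted_pairs S \<noteq> {} \<and> leftmost_inverted S = x) *
          (q / r * \<mu> S * v S * (f (swap_pair S x))\<^sup>2))"
        unfolding parent_term_def using x finite_unlike_pairs[OF S]
        by (intro sum.mono_neutral_right) (auto simp: unlike_pairs_eq)
      then have pt: "parent_term S = q / r * \<mu> S * v S * (f (swap_pair S ?x))\<^sup>2"
        using False by simp
      have "(f S - f (swap_pair S ?x))\<^sup>2 \<le> D S"
        unfolding D_def using x finite_inverted_pairs[OF S] by (intro member_le_sum) auto
      then have "(f S)\<^sup>2 \<le> q / r * (f (swap_pair S ?x))\<^sup>2 + q / (q - r) * D S"
        using square_le_weighted_squares[OF r(1) q(1), of "f S" "f (swap_pair S ?x)"] q r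
        by (smt (verit, best) divide_nonneg_pos mult_left_mono)
      then have "\<mu> S * v S * (f S)\<^sup>2 \<le> \<mu> S * v S * (q / r * (f (swap_pair S ?x))\<^sup>2 + q / (q - r) * D S)"
        using \<mu> v by (intro mult_left_mono) (auto simp: less_imp_le)
      also have "\<dots> = parent_term S + v S * (q / (q - r) * (\<mu> S * D S))"
        by (simp add: pt algebra_simps)
      also have "v S * (q / (q - r) * (\<mu> S * D S)) \<le> V * (q / (q - r) * (\<mu> S * D S))"
        using v q r \<mu> D0 by (intro mult_right_mono) (auto simp: less_imp_le)
      finally show ?thesis by (simp add: C_def mult.assoc)
    qed
    have "?I parent_term = ?I (\<lambda>S. \<Sum>x\<in>unlike_pairs S.
          of_bool (inverted_pairs (swap_pair S x) \<noteq> {} \<and> leftmost_inverted (swap_pair S x) = x) *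
            (q / r * \<mu> (swap_pair S x) * v (swap_pair S x) * (f S)\<^sup>2))"
      using config_integral_swap_pair[of "\<lambda>S x. of_bool (inverted_pairs S \<noteq> {} \<and> leftmost_inverted S = x) *
            (q / r * \<mu> S * v S * (f (swap_pair S x))\<^sup>2)"] q r \<mu> v
      by (simp add: parent_term_def[abs_def] less_imp_le)
    also have "\<dots> \<le> ?I (\<lambda>S. \<mu> S * (f S)\<^sup>2 * (v S - 1) * of_bool (inverted_pairs S \<noteq> {}))"
    proof (rule config_integral_mono)
      fix S assume S: "S \<in> pre_configs"
      let ?b = "\<lambda>x. inverted_pairs (swap_pair S x) \<noteq> {} \<and> leftmost_inverted (swap_pair S x) = x"
      let ?t = "\<lambda>x. q / r * \<mu> (swap_pair S x) * v (swap_pair S x) * (f S)\<^sup>2"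
      show "(\<Sum>x\<in>unlike_pairs S. of_bool (?b x) * ?t x) \<le>
          \<mu> S * (f S)\<^sup>2 * (v S - 1) * of_bool (inverted_pairs S \<noteq> {})"
      proof (cases "inverted_pairs S = {}")
        case False
        obtain a m where am: "leading_run S a m" using leading_run_exists[OF S False] .
        have child: "\<mu> (swap_pair S x) = r * \<mu> S" if "x \<in> children S" for x
        proof -
          have "swap_pair S x \<in> pre_configs" "inverted_pairs (swap_pair S x) \<noteq> {}"
            using S that by (simp_all add: children_def)
          then obtain b n where run: "leading_run (swap_pair S x) b n"
            by (rule leading_run_exists)
          then have "x = b + int n - 1"
            using that by (simp add: children_def leftmost_inverted_def the_leading_run_eq)
          then have "x \<in> inverted_pairs (swap_pair S x)"
            using leading_run_imp_inverted[OF run] by simp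
          then show ?thesis
            using energy_swap_pair[of "swap_pair S x" x] S by (simp add: \<mu>_def)
        qed
        have "(\<Sum>x\<in>unlike_pairs S. of_bool (?b x) * ?t x) = (\<Sum>x\<in>children S. ?t x)"
          unfolding children_def using finite_unlike_pairs[OF S]
          by (intro sum.mono_neutral_cong_right) auto
        also have "\<dots> = (\<Sum>x\<in>children S. \<mu> S * (f S)\<^sup>2 * (q * v (swap_pair S x)))"
          using r by (intro sum.cong) (auto simp: child)
        also have "\<dots> = \<mu> S * (f S)\<^sup>2 * (q * (\<Sum>x\<in>children S. v (swap_pair S x)))"
          by (simp add: sum_distrib_left)
        also have "\<dots> \<le> \<mu> S * (f S)\<^sup>2 * (v S - 1)"
          using tree_weight_children[OF q(2,3) S am] \<mu>[of S]
          by (intro mult_left_mono) (auto simp: v_def)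
        finally show ?thesis using False by simp
      qed (simp add: f0)
    qed
    finally have parents: "?I parent_term \<le> \<dots>" .
    let ?Y = "\<lambda>S. \<mu> S * (f S)\<^sup>2 * (v S - 1) * of_bool (inverted_pairs S \<noteq> {})"
    have v1: "1 \<le> v S" if S: "S \<in> pre_configs" and inv: "inverted_pairs S \<noteq> {}" for S
    proof -
      obtain a m where am: "leading_run S a m" using leading_run_exists[OF S inv] .
      have "0 \<le> q * (\<Sum>x\<in>children S. v (swap_pair S x))"
        using q v by (intro mult_nonneg_nonneg sum_nonneg) auto
      then show ?thesis using tree_weight_children[OF q(2,3) S am] by (simp add: v_def)
    qed
    have "?I ?Y + ?I (\<lambda>S. \<mu> S * (f S)\<^sup>2) = ?I (\<lambda>S. ?Y S + \<mu> S * (f S)\<^sup>2)"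
      using v1 \<mu> by (intro config_integral_add[symmetric]) (auto simp: less_imp_le)
    also have "\<dots> = ?I (\<lambda>S. \<mu> S * v S * (f S)\<^sup>2)"
      by (rule config_integral_cong) (auto simp: f0 of_bool_def algebra_simps)
    also have "\<dots> \<le> ?I (\<lambda>S. parent_term S + C * (\<mu> S * D S))"
      by (intro config_integral_mono step)
    also have "\<dots> = ?I parent_term + ennreal C * ?I (\<lambda>S. \<mu> S * D S)"
      using pt0 C \<mu> D0 by (simp add: config_integral_add config_integral_cmult less_imp_le)
    also have "\<dots> \<le> ?I ?Y + ennreal C * ?I (\<lambda>S. \<mu> S * D S)"
      by (intro add_right_mono parents)
    finally have "?I ?Y + ?I (\<lambda>S. \<mu> S * (f S)\<^sup>2) \<le> ?I ?Y + ennreal C * ?I (\<lambda>S. \<mu> S * D S)" .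
    moreover have "?I ?Y < \<infinity>"
    proof -
      have "?I ?Y \<le> ?I (\<lambda>S. V * \<mu> S)"
      proof (rule config_integral_mono)
        fix S
        have "(f S)\<^sup>2 * ((v S - 1) * of_bool (inverted_pairs S \<noteq> {})) \<le> (f S)\<^sup>2 * V"
          using v[of S] V by (intro mult_left_mono) (auto simp: of_bool_def)
        also have "\<dots> \<le> 1 * V"
          using f1[of S] V by (intro mult_right_mono) (auto simp: abs_square_le_1)
        finally have "\<mu> S * ((f S)\<^sup>2 * ((v S - 1) * of_bool (inverted_pairs S \<noteq> {}))) \<le> \<mu> S * (1 * V)"
          using \<mu>[of S] by (intro mult_left_mono) auto
        then show "?Y S \<le> V * \<mu> S" by (simp add: mult_ac)
      qed
      also have "\<dots> = ennreal V * ?I \<mu>"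
        using V \<mu> by (simp add: config_integral_cmult less_imp_le)
      also have "\<dots> < \<infinity>"
        using nn_integral_power_energy_finite[of r] r by (simp add: \<mu>_def config_integral_def ennreal_mult_less_top)
      finally show ?thesis .
    qed
    ultimately show "?I (\<lambda>S. r ^ energy S * (f S)\<^sup>2) \<le> ennreal C * ?I (\<lambda>S. r ^ energy S *
        (\<Sum>x\<in>inverted_pairs S. (f S - f (swap_pair S x))\<^sup>2))"
      unfolding \<mu>_def D_def by (auto simp: ennreal_add_left_cancel_le)
  qed
qed

section \<open>One step of the dynamics\<close>

definition swap_rate :: "real \<Rightarrow> (int \<Rightarrow> bool) \<Rightarrow> int \<Rightarrow> real" where
  "swap_rate p S x = (if S x then 1 - p else p)"

text \<open>
  This is \<open>f S\<close> plus the mean increment of \<open>f\<close>, the form in which the variance of a step can be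
  estimated. Steps without a move contribute nothing to the sum.
\<close>

definition exclusion_mean :: "real \<Rightarrow> ((int \<Rightarrow> bool) \<Rightarrow> real) \<Rightarrow> (int \<Rightarrow> bool) \<Rightarrow> real" where
  "exclusion_mean p f S =
     f S + (\<Sum>x\<in>unlike_pairs S. swap_rate p S x * (f (swap_pair S x) - f S)) / card (unlike_pairs S)"

lemma swap_rate_nonneg: "p \<in> {0..1} \<Longrightarrow> 0 \<le> swap_rate p S x"
  by (simp add: swap_rate_def)

lemma sum_unlike_pairs:
  assumes "S \<in> pre_configs"
  shows "(\<Sum>x\<in>unlike_pairs S. g x) = (\<Sum>x\<in>inverted_pairs S. g x) + (\<Sum>x\<in>ordered_pairs S. g x)"
  unfolding unlike_pairs_eq using assms
  by (intro sum.union_disjoint finite_inverted_pairs finite_ordered_pairs inverted_ordered_disjoint)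

lemma sum_swap_rate:
  fixes p :: real
  assumes "S \<in> pre_configs"
  shows "(\<Sum>x\<in>unlike_pairs S. swap_rate p S x) =
    real (card (inverted_pairs S)) * p + (real (card (inverted_pairs S)) + 1) * (1 - p)"
proof -
  have "(\<Sum>x\<in>inverted_pairs S. swap_rate p S x) = (\<Sum>x\<in>inverted_pairs S. p)"
    "(\<Sum>x\<in>ordered_pairs S. swap_rate p S x) = (\<Sum>x\<in>ordered_pairs S. 1 - p)"
    by (auto intro!: sum.cong simp: swap_rate_def inverted_pairs_def ordered_pairs_def)
  then show ?thesis
    using card_ordered_pairs[OF assms] by (simp add: sum_unlike_pairs[OF assms])
qed

lemma card_unlike_pairs_pos: "S \<in> pre_configs \<Longrightarrow> 0 < card (unlike_pairs S)"
  by (simp add: card_unlike_pairs)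

lemma finite_set_pre_step:
  assumes "S \<in> pre_configs" shows "finite (set_pmf (pre_step \<beta> p S))"
  using finite_unlike_pairs[OF assms] unlike_pairs_nonempty[OF assms]
  by (auto simp: pre_step_def voter_move_def exclusion_move_def)

lemma expectation_pre_step:
  assumes S: "S \<in> pre_configs" and p: "p \<in> {0..1}"
  shows "measure_pmf.expectation (pre_step 0 p S) f = exclusion_mean p f S"
proof -
  note fin = finite_unlike_pairs[OF S] and ne = unlike_pairs_nonempty[OF S]
  have no_voter: "bernoulli_pmf 0 = return_pmf False"
  proof (rule pmf_eqI)
    show "pmf (bernoulli_pmf 0) b = pmf (return_pmf False) b" for b by (cases b) auto
  qed
  have move: "exclusion_move p S x =
      map_pmf (\<lambda>b. if b then swap_pair S x else S) (bernoulli_pmf (swap_rate p S x))"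
    if "x \<in> unlike_pairs S" for x
  proof (cases "S x")
    case True
    then have swap: "swap_pair S x = S(x := False, x + 1 := True)"
      using that by (simp add: swap_pair_def unlike_pairs_def)
    show ?thesis unfolding swap using True by (simp add: exclusion_move_def swap_rate_def)
  next
    case False
    then have swap: "swap_pair S x = S(x := True, x + 1 := False)"
      using that by (simp add: swap_pair_def unlike_pairs_def)
    show ?thesis unfolding swap using False by (simp add: exclusion_move_def swap_rate_def)
  qed
  have "pre_step 0 p S = bind_pmf (pmf_of_set (unlike_pairs S)) (exclusion_move p S)"
    by (simp add: pre_step_def no_voter bind_return_pmf)
  then have "measure_pmf.expectation (pre_step 0 p S) f =
      (\<Sum>x\<in>unlike_pairs S. measure_pmf.expectation (exclusion_move p S x) f /\<^sub>R card (unlike_pairs S))"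
    using fin ne by (simp only:) (subst pmf_expectation_bind_pmf_of_set, auto simp: exclusion_move_def)
  also have "\<dots> = (\<Sum>x\<in>unlike_pairs S. (f S + swap_rate p S x * (f (swap_pair S x) - f S)) / card (unlike_pairs S))"
  proof (rule sum.cong[OF refl])
    fix x assume x: "x \<in> unlike_pairs S"
    have "measure_pmf.expectation (exclusion_move p S x) f =
        measure_pmf.expectation (bernoulli_pmf (swap_rate p S x)) (\<lambda>b. f (if b then swap_pair S x else S))"
      unfolding move[OF x] by simp
    also have "\<dots> = f S + swap_rate p S x * (f (swap_pair S x) - f S)"
      using p by (subst integral_bernoulli_pmf) (auto simp: swap_rate_def algebra_simps)
    finally show "measure_pmf.expectation (exclusion_move p S x) f /\<^sub>R card (unlike_pairs S) =
        (f S + swap_rate p S x * (f (swap_pair S x) - f S)) / card (unlike_pairs S)"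
      by (simp add: divide_inverse_commute)
  qed
  also have "\<dots> = exclusion_mean p f S"
    using card_unlike_pairs_pos[OF S]
    by (simp add: exclusion_mean_def sum_divide_distrib[symmetric] sum.distrib add_divide_distrib)
  finally show ?thesis .
qed

lemma exclusion_mean_bounds:
  assumes p: "p \<in> {0..1}" and f: "\<And>S. f S \<in> {0..1}"
  shows "exclusion_mean p f S \<in> {0..1}"
proof (cases "card (unlike_pairs S) = 0")
  case True
  then show ?thesis using f[of S] by (simp add: exclusion_mean_def)
next
  case False
  let ?w = "\<lambda>x. f S + swap_rate p S x * (f (swap_pair S x) - f S)"
  have w: "?w x \<in> {0..1}" for x
  proof -
    have "?w x = (1 - swap_rate p S x) * f S + swap_rate p S x * f (swap_pair S x)"
      by (simp add: algebra_simps)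
    moreover have "swap_rate p S x \<in> {0..1}" using p by (auto simp: swap_rate_def)
    ultimately show ?thesis
      using f[of S] f[of "swap_pair S x"] convex_bound_le[of "f S" 1 "f (swap_pair S x)" "1 - swap_rate p S x" "swap_rate p S x"]
      by auto
  qed
  have "exclusion_mean p f S = (\<Sum>x\<in>unlike_pairs S. ?w x) / card (unlike_pairs S)"
    using False by (simp add: exclusion_mean_def sum.distrib add_divide_distrib)
  moreover have "0 \<le> (\<Sum>x\<in>unlike_pairs S. ?w x)" using w by (intro sum_nonneg) auto
  moreover have "(\<Sum>x\<in>unlike_pairs S. ?w x) \<le> card (unlike_pairs S)"
    using w sum_bounded_above[of "unlike_pairs S" ?w 1] by simp
  ultimately show ?thesis using False by simp
qed

text \<open>
  The step does nothing with probability at least \<open>1 / 2\<close>: the pairs 10, which move only with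
  probability \<open>1 - p \<le> 1 / 2\<close>, outnumber the pairs 01 by one, so the move probabilities add up to at
  most half the number of pairs. Such laziness makes the variance of \<open>f\<close> after one step at least half
  of its mean squared increment, by the Cauchy-Schwarz inequality. The inequality states this after
  multiplication by the number of unlike pairs and with all terms on the side where they are
  nonnegative.
\<close>

lemma exclusion_mean_square:
  fixes f :: "(int \<Rightarrow> bool) \<Rightarrow> real"
  assumes S: "S \<in> pre_configs" and p: "p \<in> {1/2..1}"
  shows "card (unlike_pairs S) * (exclusion_mean p f S)\<^sup>2
      + (\<Sum>x\<in>unlike_pairs S. swap_rate p S x * (f S - f (swap_pair S x))\<^sup>2) / 2
      + (\<Sum>x\<in>unlike_pairs S. swap_rate p S x) * (f S)\<^sup>2
    \<le> card (unlike_pairs S) * (f S)\<^sup>2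
      + (\<Sum>x\<in>unlike_pairs S. swap_rate p S x * (f (swap_pair S x))\<^sup>2)"
proof -
  let ?U = "unlike_pairs S" and ?c = "swap_rate p S" and ?d = "\<lambda>x. f (swap_pair S x) - f S"
  define n where "n = real (card ?U)"
  define s where "s = (\<Sum>x\<in>?U. ?c x * ?d x)"
  define e where "e = (\<Sum>x\<in>?U. ?c x * (?d x)\<^sup>2)"
  define w where "w = (\<Sum>x\<in>?U. ?c x)"
  have n: "0 < n" using card_unlike_pairs_pos[OF S] by (simp add: n_def)
  have c: "0 \<le> ?c x" for x using p by (intro swap_rate_nonneg) auto
  have e: "0 \<le> e" using c by (auto simp: e_def intro: sum_nonneg)
  have "w = real (card (inverted_pairs S)) + (1 - p)"
    by (simp add: w_def sum_swap_rate[OF S] algebra_simps)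
  also have "\<dots> \<le> n / 2" using p by (simp add: n_def card_unlike_pairs[OF S])
  finally have w: "w \<le> n / 2" .
  have "s\<^sup>2 = (\<Sum>x\<in>?U. sqrt (?c x) * (sqrt (?c x) * ?d x))\<^sup>2"
    using c by (simp add: s_def mult.assoc[symmetric])
  also have "\<dots> \<le> (\<Sum>x\<in>?U. (sqrt (?c x))\<^sup>2) * (\<Sum>x\<in>?U. (sqrt (?c x) * ?d x)\<^sup>2)"
    by (rule Cauchy_Schwarz_ineq_sum)
  also have "\<dots> = w * e"
    using c by (simp add: w_def e_def power_mult_distrib)
  also have "\<dots> \<le> n / 2 * e" using w e by (rule mult_right_mono)
  finally have s: "s\<^sup>2 / n \<le> e / 2" using n by (simp add: field_simps)
  have "(\<Sum>x\<in>?U. ?c x * (f (swap_pair S x))\<^sup>2) =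
      (\<Sum>x\<in>?U. ?c x * (f S)\<^sup>2 + 2 * f S * (?c x * ?d x) + ?c x * (?d x)\<^sup>2)"
    by (intro sum.cong) (auto simp: power2_eq_square algebra_simps)
  also have "\<dots> = w * (f S)\<^sup>2 + 2 * f S * s + e"
    by (simp add: w_def s_def e_def sum.distrib sum_distrib_left sum_distrib_right)
  finally have swapped: "(\<Sum>x\<in>?U. ?c x * (f (swap_pair S x))\<^sup>2) = \<dots>" .
  have "n * (exclusion_mean p f S)\<^sup>2 = n * (f S + s / n)\<^sup>2"
    by (simp add: exclusion_mean_def s_def n_def)
  also have "\<dots> = n * (f S)\<^sup>2 + 2 * f S * s + s\<^sup>2 / n"
    using n by (simp add: power2_eq_square field_simps)
  finally have mean: "n * (exclusion_mean p f S)\<^sup>2 = \<dots>" .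
  have e_eq: "(\<Sum>x\<in>?U. ?c x * (f S - f (swap_pair S x))\<^sup>2) = e"
    by (simp add: e_def power2_commute)
  show ?thesis
    unfolding n_def[symmetric]
    unfolding swapped e_eq mean w_def[symmetric] using s by linarith
qed

text \<open>
  The weight \<open>card (unlike_pairs S) * r ^ energy S\<close> with \<open>r = (1 - p) / p\<close> is reversible for the
  dynamics, but it degenerates as \<open>p\<close> tends to 1. Bounding \<open>r\<close> below by \<open>1 / 2\<close> keeps it positive,
  and it remains subinvariant as far as configurations with a pair 01 are concerned.
\<close>

definition blocking_ratio :: "real \<Rightarrow> real" where
  "blocking_ratio p = max ((1 - p) / p) (1 / 2)"

lemma blocking_ratio_bounds:
  assumes "1/2 < p" "p \<le> 1"
  shows "0 < blocking_ratio p" "blocking_ratio p < 1"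
  using assms by (auto simp: blocking_ratio_def max_def)

text \<open>
  With \<open>N\<close> pairs 01 and \<open>N + 1\<close> pairs 10, the inflow minus the outflow is proportional to
  \<open>(p r - (1 - p)) (N + 1 - N / r)\<close>. The first factor vanishes for \<open>r = (1 - p) / p\<close>; for
  \<open>r = 1 / 2\<close> it is nonnegative, while the second factor is \<open>1 - N \<le> 0\<close>.
\<close>

lemma blocking_weight_subinvariant:
  assumes S: "S \<in> pre_configs" and inv: "inverted_pairs S \<noteq> {}" and p: "1/2 < p" "p \<le> 1"
  defines "r \<equiv> blocking_ratio p"
  shows "(\<Sum>x\<in>unlike_pairs S. r ^ energy (swap_pair S x) * swap_rate p (swap_pair S x) x) \<le>
    r ^ energy S * (\<Sum>x\<in>unlike_pairs S. swap_rate p S x)"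
proof -
  let ?N = "real (card (inverted_pairs S))"
  have r: "0 < r" using blocking_ratio_bounds[OF p] by (simp add: r_def)
  have N: "1 \<le> ?N" using inv finite_inverted_pairs[OF S] by (simp add: Suc_le_eq card_gt_0_iff)
  have inverted: "r ^ energy (swap_pair S x) * swap_rate p (swap_pair S x) x = r ^ energy S * ((1 - p) / r)"
    if "x \<in> inverted_pairs S" for x
    using energy_swap_pair[OF S that] that r
    by (simp add: swap_rate_def swap_pair_apply inverted_pairs_def)
  have ordered: "r ^ energy (swap_pair S x) * swap_rate p (swap_pair S x) x = r ^ energy S * (p * r)"
    if "x \<in> ordered_pairs S" for x
  proof -
    have "x \<in> inverted_pairs (swap_pair S x)"
      using that by (simp add: inverted_pairs_def ordered_pairs_def swap_pair_apply)
    then show ?thesis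
      using energy_swap_pair[of "swap_pair S x" x] S that
      by (simp add: swap_rate_def swap_pair_apply ordered_pairs_def)
  qed
  have "(\<Sum>x\<in>unlike_pairs S. r ^ energy (swap_pair S x) * swap_rate p (swap_pair S x) x) =
      r ^ energy S * (?N * ((1 - p) / r) + (?N + 1) * (p * r))"
  proof -
    have "(\<Sum>x\<in>inverted_pairs S. r ^ energy (swap_pair S x) * swap_rate p (swap_pair S x) x) =
        (\<Sum>x\<in>inverted_pairs S. r ^ energy S * ((1 - p) / r))"
      by (intro sum.cong refl inverted)
    moreover have "(\<Sum>x\<in>ordered_pairs S. r ^ energy (swap_pair S x) * swap_rate p (swap_pair S x) x) =
        (\<Sum>x\<in>ordered_pairs S. r ^ energy S * (p * r))"
      by (intro sum.cong refl ordered)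
    ultimately show ?thesis
      using card_ordered_pairs[OF S] by (simp add: sum_unlike_pairs[OF S] distrib_left mult_ac)
  qed
  also have "\<dots> \<le> r ^ energy S * (?N * p + (?N + 1) * (1 - p))"
  proof -
    have "(p * r - (1 - p)) * ((?N + 1) - ?N / r) \<le> 0"
    proof (cases "r = (1 - p) / p")
      case True then show ?thesis using p by simp
    next
      case False
      then have "r = 1 / 2" "(1 - p) / p \<le> r" by (auto simp: r_def blocking_ratio_def max_def split: if_splits)
      then have "0 \<le> p * r - (1 - p)" "(?N + 1) - ?N / r \<le> 0"
        using N p by (simp_all add: \<open>r = 1 / 2\<close> field_simps)
      then show ?thesis by (rule mult_nonneg_nonpos)
    qed
    then have "?N * ((1 - p) / r) + (?N + 1) * (p * r) \<le> ?N * p + (?N + 1) * (1 - p)"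
      using r by (simp add: field_simps)
    then show ?thesis using r by (intro mult_left_mono) auto
  qed
  finally show ?thesis by (simp add: sum_swap_rate[OF S])
qed

section \<open>Decay of the survival probability\<close>

text \<open>
  The energy is at least about half the number of unlike pairs, so part of the exponential decay in
  the energy can be spent on the number of pairs. With \<open>r = exp (- 8 * l)\<close>, one half of the exponent
  keeps the series summable; the other half pays for the linear factor and for the tail bound, with \<open>2 l\<close> per
  unit of energy each.
\<close>

lemma config_integral_weight_tail:
  fixes r :: real
  assumes r: "0 < r" "r < 1"
  obtains C l where "0 < C" "0 < l"
    "\<And>K. config_integral (\<lambda>S. r ^ energy S * card (unlike_pairs S) * of_bool (K < real (card (unlike_pairs S))))
      \<le> ennreal (C * exp (- l * K))"
proof -
  define l where "l = - ln r / 8"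
  have l: "0 < l" using r by (simp add: l_def)
  have r_eq: "r = exp (- 8 * l)" using r by (simp add: l_def)
  define Z where "Z = config_integral (\<lambda>S. exp (- 4 * l) ^ energy S)"
  have Z: "Z < \<infinity>"
    using nn_integral_power_energy_finite[of "exp (- 4 * l)"] l by (simp add: Z_def config_integral_def)
  define C where "C = exp (6 * l) / l * enn2real Z + 1"
  have C: "0 < C" unfolding C_def using l by (intro add_nonneg_pos mult_nonneg_nonneg) auto
  show thesis
  proof (rule that[OF C l])
    fix K :: real
    let ?B = "exp (- l * K) * (exp (6 * l) / l)"
    have B: "0 \<le> ?B" using l by simp
    have "config_integral (\<lambda>S. r ^ energy S * card (unlike_pairs S) * of_bool (K < card (unlike_pairs S)))
        \<le> config_integral (\<lambda>S. ?B * exp (- 4 * l) ^ energy S)"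
    proof (rule config_integral_mono)
      fix S assume S: "S \<in> pre_configs"
      let ?n = "real (card (unlike_pairs S))" and ?E = "real (energy S)"
      have n: "?n \<le> 2 * ?E + 3" using card_unlike_pairs_le_energy[OF S] by linarith
      show "r ^ energy S * ?n * of_bool (K < ?n) \<le> ?B * exp (- 4 * l) ^ energy S"
      proof (cases "K < ?n")
        case True
        have "l * ?n \<le> exp (l * ?n)" using exp_ge_add_one_self[of "l * ?n"] by linarith
        then have "?n \<le> exp (l * ?n) / l" using l by (simp add: field_simps)
        then have "r ^ energy S * ?n \<le> exp (- 8 * l * ?E) * (exp (l * ?n) / l)"
          unfolding r_eq exp_of_nat_mult[symmetric]
          by (subst mult.commute[of "- 8 * l"], intro mult_left_mono) auto
        also have "\<dots> = exp (- 8 * l * ?E + l * ?n) / l"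
          by (simp only: exp_add times_divide_eq_right)
        also have "\<dots> \<le> exp (- l * K + 6 * l - 4 * l * ?E) / l"
        proof -
          have "l * (?n + K) \<le> l * (2 * (2 * ?E + 3))" using n True l by (intro mult_left_mono) auto
          then show ?thesis using l by (intro divide_right_mono) (auto simp: algebra_simps)
        qed
        also have "\<dots> = ?B * exp (- 4 * l) ^ energy S"
          by (simp add: exp_add exp_diff exp_of_nat_mult[symmetric] exp_minus field_simps)
        finally show ?thesis using True by simp
      next
        case False
        then show ?thesis using mult_nonneg_nonneg[OF B, of "exp (- 4 * l) ^ energy S"] by simp
      qed
    qed
    also have "\<dots> = ennreal ?B * Z"
      unfolding Z_def using B by (intro config_integral_cmult) auto
    also have "\<dots> = ennreal (?B * enn2real Z)"
      using Z B by (subst ennreal_mult) auto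
    also have "\<dots> \<le> ennreal (C * exp (- l * K))"
      by (intro ennreal_leI) (simp add: C_def algebra_simps)
    finally show "config_integral (\<lambda>S. r ^ energy S * card (unlike_pairs S) * of_bool (K < card (unlike_pairs S)))
        \<le> ennreal (C * exp (- l * K))" .
  qed
qed

text \<open>
  Summing the one-step inequality over all configurations, the flow of \<open>f\<^sup>2\<close> cancels by mass transport
  and subinvariance. Of the variance only the part from the pairs 01 is kept, which are swapped
  with probability \<open>p \<ge> 1 / 2\<close>. The dominated function \<open>g\<close> allows
  the mean to be replaced by 0 on the ordered configurations.
\<close>

lemma energy_dissipation:
  fixes f g :: "(int \<Rightarrow> bool) \<Rightarrow> real"
  assumes p: "1/2 < p" "p \<le> 1"
    and f1: "\<And>S. \<bar>f S\<bar> \<le> 1" and f0: "\<And>S. inverted_pairs S = {} \<Longrightarrow> f S = 0"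
    and g: "\<And>S. S \<in> pre_configs \<Longrightarrow> \<bar>g S\<bar> \<le> \<bar>exclusion_mean p f S\<bar>"
  defines "\<mu> \<equiv> \<lambda>S. blocking_ratio p ^ energy S"
  shows "config_integral (\<lambda>S. \<mu> S * card (unlike_pairs S) * (g S)\<^sup>2)
      + ennreal (1 / 4) * config_integral (\<lambda>S. \<mu> S * (\<Sum>x\<in>inverted_pairs S. (f S - f (swap_pair S x))\<^sup>2))
    \<le> config_integral (\<lambda>S. \<mu> S * card (unlike_pairs S) * (f S)\<^sup>2)"
proof -
  note r = blocking_ratio_bounds[OF p]
  have \<mu>: "0 < \<mu> S" for S using r by (simp add: \<mu>_def)
  have c: "0 \<le> swap_rate p S x" for S x using p by (intro swap_rate_nonneg) auto
  define n where "n S = real (card (unlike_pairs S))" for S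
  define D where "D S = (\<Sum>x\<in>inverted_pairs S. (f S - f (swap_pair S x))\<^sup>2)" for S
  \<comment> \<open>outflow and inflow of \<open>f\<^sup>2\<close>; the outflow has finite total mass and is cancelled at the end\<close>
  define stay where "stay S = \<mu> S * (\<Sum>x\<in>unlike_pairs S. swap_rate p S x) * (f S)\<^sup>2" for S
  define move where "move S = (\<Sum>x\<in>unlike_pairs S. \<mu> S * swap_rate p S x * (f (swap_pair S x))\<^sup>2)" for S
  have D0: "0 \<le> D S" for S by (auto simp: D_def intro: sum_nonneg)
  have stay0: "0 \<le> stay S" for S
    using \<mu> c by (auto simp: stay_def less_imp_le intro!: mult_nonneg_nonneg sum_nonneg)
  have move0: "0 \<le> move S" for S
    using \<mu> c by (auto simp: move_def less_imp_le intro!: mult_nonneg_nonneg sum_nonneg)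
  have n0: "0 \<le> n S" for S by (simp add: n_def)
  have pointwise: "(\<mu> S * n S * (g S)\<^sup>2 + 1 / 4 * (\<mu> S * D S)) + stay S \<le> \<mu> S * n S * (f S)\<^sup>2 + move S"
    if S: "S \<in> pre_configs" for S
  proof -
    let ?e = "\<Sum>x\<in>unlike_pairs S. swap_rate p S x * (f S - f (swap_pair S x))\<^sup>2"
    have "1 / 2 * D S = (\<Sum>x\<in>inverted_pairs S. 1 / 2 * (f S - f (swap_pair S x))\<^sup>2)"
      by (simp add: D_def sum_distrib_left)
    also have "\<dots> \<le> (\<Sum>x\<in>inverted_pairs S. swap_rate p S x * (f S - f (swap_pair S x))\<^sup>2)"
      using p by (intro sum_mono mult_right_mono) (auto simp: swap_rate_def inverted_pairs_def)
    also have "\<dots> \<le> ?e"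
      using c finite_unlike_pairs[OF S] by (intro sum_mono2) (auto simp: unlike_pairs_eq)
    finally have "1 / 4 * D S \<le> ?e / 2" by simp
    moreover have "n S * (g S)\<^sup>2 \<le> n S * (exclusion_mean p f S)\<^sup>2"
      using g[OF S] n0 by (intro mult_left_mono) (auto simp: abs_le_square_iff)
    ultimately have "n S * (g S)\<^sup>2 + 1 / 4 * D S + (\<Sum>x\<in>unlike_pairs S. swap_rate p S x) * (f S)\<^sup>2 \<le>
        n S * (f S)\<^sup>2 + (\<Sum>x\<in>unlike_pairs S. swap_rate p S x * (f (swap_pair S x))\<^sup>2)"
      using exclusion_mean_square[OF S, of p f] p by (simp add: n_def)
    from mult_left_mono[OF this less_imp_le[OF \<mu>[of S]]]
    have "\<mu> S * (n S * (g S)\<^sup>2 + 1 / 4 * D S + (\<Sum>x\<in>unlike_pairs S. swap_rate p S x) * (f S)\<^sup>2) \<le>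
        \<mu> S * (n S * (f S)\<^sup>2 + (\<Sum>x\<in>unlike_pairs S. swap_rate p S x * (f (swap_pair S x))\<^sup>2))" .
    moreover have "\<mu> S * (\<Sum>x\<in>unlike_pairs S. swap_rate p S x * (f (swap_pair S x))\<^sup>2) = move S"
      by (simp add: move_def sum_distrib_left mult.assoc)
    ultimately show ?thesis
      by (simp add: stay_def distrib_left mult.assoc)
  qed
  have "config_integral move =
      config_integral (\<lambda>S. \<Sum>x\<in>unlike_pairs S. \<mu> (swap_pair S x) * swap_rate p (swap_pair S x) x * (f S)\<^sup>2)"
    unfolding move_def[abs_def] using \<mu> c
      config_integral_swap_pair[of "\<lambda>S x. \<mu> (swap_pair S x) * swap_rate p (swap_pair S x) x * (f S)\<^sup>2"]
    by (simp add: less_imp_le)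
  also have "\<dots> \<le> config_integral stay"
  proof (rule config_integral_mono)
    fix S assume S: "S \<in> pre_configs"
    show "(\<Sum>x\<in>unlike_pairs S. \<mu> (swap_pair S x) * swap_rate p (swap_pair S x) x * (f S)\<^sup>2) \<le> stay S"
    proof (cases "inverted_pairs S = {}")
      case False
      show ?thesis
        unfolding stay_def sum_distrib_right[symmetric]
        using blocking_weight_subinvariant[OF S False p]
        by (intro mult_right_mono) (auto simp: \<mu>_def)
    qed (simp add: f0 stay_def)
  qed
  finally have flux: "config_integral move \<le> config_integral stay" .
  have "(config_integral (\<lambda>S. \<mu> S * n S * (g S)\<^sup>2) + ennreal (1 / 4) * config_integral (\<lambda>S. \<mu> S * D S)) + config_integral stay
      = config_integral (\<lambda>S. (\<mu> S * n S * (g S)\<^sup>2 + 1 / 4 * (\<mu> S * D S)) + stay S)"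
    using \<mu> D0 n0 stay0
    by (subst config_integral_add, simp add: less_imp_le, simp, subst config_integral_add)
      (auto simp: less_imp_le config_integral_cmult[symmetric])
  also have "\<dots> \<le> config_integral (\<lambda>S. \<mu> S * n S * (f S)\<^sup>2 + move S)"
    by (intro config_integral_mono pointwise)
  also have "\<dots> = config_integral (\<lambda>S. \<mu> S * n S * (f S)\<^sup>2) + config_integral move"
    using \<mu> n0 move0 by (intro config_integral_add) (auto simp: less_imp_le)
  also have "\<dots> \<le> config_integral (\<lambda>S. \<mu> S * n S * (f S)\<^sup>2) + config_integral stay"
    by (intro add_left_mono flux)
  finally have total: "config_integral stay + (config_integral (\<lambda>S. \<mu> S * n S * (g S)\<^sup>2) + ennreal (1 / 4) * config_integral (\<lambda>S. \<mu> S * D S))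
      \<le> config_integral stay + config_integral (\<lambda>S. \<mu> S * n S * (f S)\<^sup>2)"
    by (simp add: add.commute)
  have "config_integral stay < \<infinity>"
  proof -
    obtain C l where Cl: "0 < C" "0 < l" "\<And>K. config_integral (\<lambda>S. \<mu> S * card (unlike_pairs S) *
        of_bool (K < real (card (unlike_pairs S)))) \<le> ennreal (C * exp (- l * K))"
      unfolding \<mu>_def using config_integral_weight_tail[OF r] by blast
    have "config_integral stay \<le>
        config_integral (\<lambda>S. \<mu> S * card (unlike_pairs S) * of_bool (0 < real (card (unlike_pairs S))))"
    proof (rule config_integral_mono)
      fix S assume S: "S \<in> pre_configs"
      have "(\<Sum>x\<in>unlike_pairs S. swap_rate p S x) \<le> (\<Sum>x\<in>unlike_pairs S. 1)"
        using p by (intro sum_mono) (auto simp: swap_rate_def)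
      then have "(\<Sum>x\<in>unlike_pairs S. swap_rate p S x) * (f S)\<^sup>2 \<le> n S * 1"
        using f1[of S] c by (intro mult_mono) (auto simp: n_def abs_square_le_1 intro: sum_nonneg)
      then show "stay S \<le> \<mu> S * card (unlike_pairs S) * of_bool (0 < real (card (unlike_pairs S)))"
        using \<mu>[of S] card_unlike_pairs_pos[OF S] by (simp add: stay_def n_def mult.assoc)
    qed
    also note Cl(3)[of 0]
    finally show ?thesis by (rule le_less_trans) simp
  qed
  with total show ?thesis
    by (auto simp: ennreal_add_left_cancel_le n_def D_def)
qed

primrec survival :: "real \<Rightarrow> nat \<Rightarrow> (int \<Rightarrow> bool) \<Rightarrow> real" where
  "survival p 0 S = of_bool (inverted_pairs S \<noteq> {})"
| "survival p (Suc t) S = of_bool (inverted_pairs S \<noteq> {}) * exclusion_mean p (survival p t) S"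

lemma survival_bounds:
  assumes "p \<in> {0..1}" shows "survival p t S \<in> {0..1}"
proof (induction t arbitrary: S)
  case (Suc t)
  then show ?case using exclusion_mean_bounds[OF assms, of "survival p t" S] by auto
qed simp

text \<open>
  Where fewer than \<open>K\<close> pairs are present, \<open>b\<close> controls \<open>a\<close> up to the factor \<open>K\<close>, so \<open>a\<close> contracts
  at rate \<open>\<kappa> / K\<close> down to an error that is exponentially small in \<open>K\<close>. The choice \<open>K = sqrt t\<close>
  balances the two exponents.
\<close>

lemma stretched_decay:
  fixes a b :: "nat \<Rightarrow> real"
  assumes dissipation: "\<And>t. a (Suc t) + \<kappa> * b t \<le> a t"
    and tail: "\<And>t K. 1 \<le> K \<Longrightarrow> a t \<le> K * b t + C * exp (- l * K)"
    and \<kappa>: "0 < \<kappa>" "\<kappa> \<le> 1" and l: "0 < l" and C: "0 \<le> C" and a: "\<And>t. 0 \<le> a t"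
  shows "a t \<le> (a 0 + C) * exp (- min \<kappa> l * sqrt t)"
proof (cases "t = 0")
  case False
  define K where "K = sqrt t"
  have K: "1 \<le> K" using False by (simp add: K_def)
  define \<delta> where "\<delta> = C * exp (- l * K)"
  have \<delta>: "0 \<le> \<delta>" using C by (simp add: \<delta>_def)
  have contract: "a i - \<delta> \<le> exp (- \<kappa> / K * i) * a 0" for i
  proof (induction i)
    case (Suc i)
    have "\<kappa> / K \<le> 1" using \<kappa> K by (simp add: field_simps)
    have "(a i - \<delta>) / K \<le> b i" using tail[OF K, of i] K by (simp add: \<delta>_def field_simps)
    then have "\<kappa> * ((a i - \<delta>) / K) \<le> \<kappa> * b i" using \<kappa> by (intro mult_left_mono) auto
    then have "a (Suc i) - \<delta> \<le> (a i - \<delta>) - \<kappa> * ((a i - \<delta>) / K)"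
      using dissipation[of i] by simp
    also have "\<dots> = (1 - \<kappa> / K) * (a i - \<delta>)"
      by (simp add: left_diff_distrib)
    finally have "a (Suc i) - \<delta> \<le> \<dots>" .
    also have "(1 - \<kappa> / K) * (a i - \<delta>) \<le> (1 - \<kappa> / K) * (exp (- \<kappa> / K * i) * a 0)"
      using Suc \<open>\<kappa> / K \<le> 1\<close> by (intro mult_left_mono) auto
    also have "\<dots> \<le> exp (- \<kappa> / K) * (exp (- \<kappa> / K * i) * a 0)"
      using exp_ge_add_one_self[of "- \<kappa> / K"] a[of 0] by (intro mult_right_mono) auto
    also have "\<dots> = exp (- \<kappa> / K * Suc i) * a 0"
      by (simp add: exp_add[symmetric] algebra_simps)
    finally show ?case .
  qed (use \<delta> in simp)
  have "\<kappa> / K * t = \<kappa> * K"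
    using K by (simp add: K_def real_div_sqrt field_simps)
  then have "a t \<le> exp (- \<kappa> * K) * a 0 + C * exp (- l * K)"
    using contract[of t] by (simp add: \<delta>_def)
  also have "\<dots> \<le> exp (- min \<kappa> l * K) * a 0 + C * exp (- min \<kappa> l * K)"
    using a[of 0] C K by (intro add_mono mult_right_mono mult_left_mono) (auto intro: mult_right_mono)
  finally show ?thesis by (simp add: K_def algebra_simps)
qed (use C in simp)

text \<open>
  The dissipation controls, through the Hardy inequality, only the norm with weight \<open>r ^ energy S\<close>,
  which lacks the number of unlike pairs as a factor. As this factor is unbounded no exponential
  rate results, but its exponential tails cost no more than a square root in the exponent. A bound
  on the norm is a bound at each configuration, since each has positive weight.
\<close>

lemma survival_stretched_exponential:
  assumes p: "1/2 < p" "p \<le> 1"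
  obtains c where "0 < c"
    "\<And>S. S \<in> pre_configs \<Longrightarrow> \<exists>A\<ge>0. \<forall>t. survival p t S \<le> A * exp (- c * sqrt t)"
proof -
  define r where "r = blocking_ratio p"
  have r: "0 < r" "r < 1" using blocking_ratio_bounds[OF p] by (auto simp: r_def)
  define n where "n S = real (card (unlike_pairs S))" for S
  let ?u = "survival p"
  define a' where "a' t = config_integral (\<lambda>S. r ^ energy S * n S * (?u t S)\<^sup>2)" for t
  define b' where "b' t = config_integral (\<lambda>S. r ^ energy S * (?u t S)\<^sup>2)" for t
  have p': "p \<in> {0..1}" using p by simp
  have u: "0 \<le> ?u t S" "?u t S \<le> 1" "\<bar>?u t S\<bar> \<le> 1" for t S using survival_bounds[OF p', of t S] by auto
  have u0: "?u t S = 0" if "inverted_pairs S = {}" for t S using that by (cases t) auto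
  obtain H where H: "0 < H" "\<And>f :: (int \<Rightarrow> bool) \<Rightarrow> real. (\<And>S. \<bar>f S\<bar> \<le> 1) \<Longrightarrow>
      (\<And>S. inverted_pairs S = {} \<Longrightarrow> f S = 0) \<Longrightarrow>
      config_integral (\<lambda>S. r ^ energy S * (f S)\<^sup>2) \<le>
      ennreal H * config_integral (\<lambda>S. r ^ energy S *
        (\<Sum>x\<in>inverted_pairs S. (f S - f (swap_pair S x))\<^sup>2))"
    using Hardy_inequality[OF r] by blast
  obtain C l where C: "0 < C" and l: "0 < l" and tail:
    "\<And>K. config_integral (\<lambda>S. r ^ energy S * n S * of_bool (K < n S)) \<le> ennreal (C * exp (- l * K))"
    unfolding n_def using config_integral_weight_tail[OF r] by blast
  define \<kappa> where "\<kappa> = min 1 (1 / (4 * H))"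
  have \<kappa>: "0 < \<kappa>" "\<kappa> \<le> 1" "\<kappa> * H \<le> 1 / 4" using H by (auto simp: \<kappa>_def min_def field_simps)
  have diss': "a' (Suc t) + ennreal \<kappa> * b' t \<le> a' t" for t
  proof -
    let ?D = "config_integral (\<lambda>S. r ^ energy S * (\<Sum>x\<in>inverted_pairs S. (?u t S - ?u t (swap_pair S x))\<^sup>2))"
    have "ennreal \<kappa> * b' t \<le> ennreal \<kappa> * (ennreal H * ?D)"
      unfolding b'_def by (intro mult_left_mono H u u0) auto
    also have "\<dots> = ennreal (\<kappa> * H) * ?D"
      using \<kappa> H by (simp add: ennreal_mult mult.assoc)
    also have "\<dots> \<le> ennreal (1 / 4) * ?D"
      using \<kappa> by (intro mult_right_mono ennreal_leI) auto
    finally have "a' (Suc t) + ennreal \<kappa> * b' t \<le> a' (Suc t) + ennreal (1 / 4) * ?D"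
      by (intro add_left_mono)
    also have "\<dots> \<le> a' t"
      unfolding a'_def r_def n_def by (intro energy_dissipation p u u0) auto
    finally show ?thesis .
  qed
  have tail': "a' t \<le> ennreal K * b' t + ennreal (C * exp (- l * K))" if K: "1 \<le> K" for t K
  proof -
    have "a' t \<le> config_integral (\<lambda>S. K * (r ^ energy S * (?u t S)\<^sup>2) + r ^ energy S * n S * of_bool (K < n S))"
      unfolding a'_def
    proof (rule config_integral_mono)
      fix S
      have sq: "0 \<le> (?u t S)\<^sup>2" "(?u t S)\<^sup>2 \<le> 1" using u(3)[of t S] by (auto simp: abs_square_le_1)
      have "n S * (?u t S)\<^sup>2 \<le> K * (?u t S)\<^sup>2 + n S * of_bool (K < n S)"
      proof (cases "K < n S")
        case True
        have "n S * (?u t S)\<^sup>2 \<le> n S * 1" using sq by (intro mult_left_mono) (auto simp: n_def)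
        then show ?thesis using True K sq by (simp add: add_increasing)
      next
        case False
        then show ?thesis using sq by (simp add: mult_right_mono)
      qed
      from mult_left_mono[OF this, of "r ^ energy S"]
      show "r ^ energy S * n S * (?u t S)\<^sup>2 \<le> K * (r ^ energy S * (?u t S)\<^sup>2) + r ^ energy S * n S * of_bool (K < n S)"
        using r by (simp add: algebra_simps)
    qed
    also have "\<dots> = ennreal K * b' t + config_integral (\<lambda>S. r ^ energy S * n S * of_bool (K < n S))"
      unfolding b'_def using K r by (subst config_integral_add) (auto simp: config_integral_cmult n_def)
    also have "\<dots> \<le> ennreal K * b' t + ennreal (C * exp (- l * K))"
      by (intro add_left_mono tail)
    finally show ?thesis .
  qed
  have fin_b: "b' t < \<infinity>" for t
  proof -
    have "b' t \<le> config_integral (\<lambda>S. r ^ energy S)"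
      unfolding b'_def using u(3) r
      by (intro config_integral_mono mult_left_le) (auto simp: abs_square_le_1)
    also have "\<dots> < \<infinity>" using nn_integral_power_energy_finite[of r] r by (simp add: config_integral_def)
    finally show ?thesis .
  qed
  have fin_a: "a' t < \<infinity>" for t
    using tail'[of 1 t] fin_b[of t] by (auto simp: ennreal_mult_less_top intro: le_less_trans)
  define a where "a t = enn2real (a' t)" for t
  define b where "b t = enn2real (b' t)" for t
  have ab: "a' t = ennreal (a t)" "b' t = ennreal (b t)" "0 \<le> a t" "0 \<le> b t" for t
    using fin_a[of t] fin_b[of t] by (auto simp: a_def b_def)
  have decay: "a t \<le> (a 0 + C) * exp (- min \<kappa> l * sqrt t)" for t
  proof (rule stretched_decay[of a \<kappa> b C l])
    show "a (Suc t) + \<kappa> * b t \<le> a t" for t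
      using diss'[of t] \<kappa> ab(3,4) unfolding ab
      by (simp add: ennreal_mult[symmetric] ennreal_plus[symmetric] del: ennreal_plus)
    show "a t \<le> K * b t + C * exp (- l * K)" if "1 \<le> K" for t K
      using tail'[OF that, of t] that C ab(3,4) unfolding ab
      by (simp add: ennreal_mult[symmetric] ennreal_plus[symmetric] del: ennreal_plus)
  qed (use \<kappa> l C ab in auto)
  define c where "c = min \<kappa> l / 2"
  have c: "0 < c" using \<kappa> l by (simp add: c_def)
  show thesis
  proof (rule that[OF c])
    fix S assume S: "S \<in> pre_configs"
    define w where "w = r ^ energy S * n S"
    have w: "0 < w" using r card_unlike_pairs_pos[OF S] by (simp add: w_def n_def)
    define A where "A = sqrt ((a 0 + C) / w)"
    have "?u t S \<le> A * exp (- c * sqrt t)" for t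
    proof -
      have "ennreal (w * (?u t S)\<^sup>2) \<le> a' t"
        unfolding a'_def config_integral_def w_def
        by (rule nn_integral_ge_point[of S pre_configs "\<lambda>S. ennreal (r ^ energy S * n S * (?u t S)\<^sup>2)", OF S])
      then have "w * (?u t S)\<^sup>2 \<le> a t" by (simp add: ab)
      also note decay
      also have "exp (- min \<kappa> l * sqrt t) = (exp (- c * sqrt t))\<^sup>2"
        by (simp add: c_def power2_eq_square exp_add[symmetric])
      finally have "(?u t S)\<^sup>2 \<le> (a 0 + C) / w * (exp (- c * sqrt t))\<^sup>2"
        using w by (simp add: field_simps)
      also have "\<dots> = (A * exp (- c * sqrt t))\<^sup>2"
        using w ab(3)[of 0] C by (simp add: A_def power_mult_distrib)
      finally show ?thesis
        by (rule power2_le_imp_le) (use w ab(3)[of 0] C in \<open>simp add: A_def\<close>)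
    qed
    moreover have "0 \<le> A" using w ab(3)[of 0] C by (simp add: A_def)
    ultimately show "\<exists>A\<ge>0. \<forall>t. ?u t S \<le> A * exp (- c * sqrt t)" by blast
  qed
qed

section \<open>The process and its relaxation time\<close>

text \<open>
  Without a pair 01 there is exactly one pair 10, hence a single block of 1's followed by 0's.
\<close>

lemma config_class_ground_iff:
  assumes S: "S \<in> pre_configs"
  shows "config_class S = ground_state \<longleftrightarrow> inverted_pairs S = {}"
proof -
  have G: "(\<lambda>x::int. x < 0) \<in> pre_configs"
    by (rule pre_configsI[of 0 _ 0]) auto
  have "config_class S = ground_state \<longleftrightarrow> (\<exists>k. \<forall>x. (x < 0) = S (x + k))"
    unfolding ground_state_def config_class_eq_iff[OF S G] using S G by (simp add: translates_def)
  also have "\<dots> \<longleftrightarrow> inverted_pairs S = {}"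
  proof
    assume "\<exists>k. \<forall>x. (x < 0) = S (x + k)"
    then obtain k where k: "\<And>x. (x < 0) = S (x + k)" by blast
    have "S y = (y < k)" for y using k[of "y - k"] by auto
    then have "S = (\<lambda>y. y < k)" by blast
    then show "inverted_pairs S = {}" by (auto simp: inverted_pairs_def)
  next
    assume none: "inverted_pairs S = {}"
    have "card (ordered_pairs S) = 1" using card_ordered_pairs[OF S] none by simp
    then obtain k where k: "ordered_pairs S = {k}" by (auto simp: card_1_singleton_iff)
    have down: "S x" if "S (x + 1)" for x
      using none that by (auto simp: inverted_pairs_def)
    have left: "S (k - int n)" for n
    proof (induction n)
      case 0
      then show ?case using k by (auto simp: ordered_pairs_def)
    next
      case (Suc n)
      then show ?case using down[of "k - int (Suc n)"] by (simp add: algebra_simps)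
    qed
    have right: "\<not> S (k + 1 + int n)" for n
    proof (induction n)
      case 0
      then show ?case using k by (auto simp: ordered_pairs_def)
    next
      case (Suc n)
      then show ?case using down[of "k + 1 + int n"] by (auto simp: algebra_simps)
    qed
    have "(x < 0) = S (x + (k + 1))" for x
      using left[of "nat (- x - 1)"] right[of "nat x"] by (cases "x < 0") (auto simp: algebra_simps)
    then show "\<exists>k. \<forall>x. (x < 0) = S (x + k)" by blast
  qed
  finally show ?thesis .
qed

text \<open>
  In contrast to \<^const>\<open>survival\<close> the initial time does not count: \<^const>\<open>relaxation_time\<close> is a
  return time if the process starts in the ground state.
\<close>

primrec avoidance :: "real \<Rightarrow> nat \<Rightarrow> (int \<Rightarrow> bool) set \<Rightarrow> real" where
  "avoidance p 0 C = 1"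
| "avoidance p (Suc t) C =
     measure_pmf.expectation (step 0 p C) (\<lambda>C'. of_bool (C' \<noteq> ground_state) * avoidance p t C')"

text \<open>
  The first step may start in the ground state; from time 1 on, avoiding the class of the ground state
  means survival of any representative.
\<close>

lemma avoidance_Suc_eq_exclusion_mean:
  assumes p: "p \<in> {0..1}" and S: "S \<in> pre_configs"
  shows "avoidance p (Suc t) (config_class S) = exclusion_mean p (survival p t) S"
  using S
proof (induction t arbitrary: S)
  have step: "avoidance p (Suc t) (config_class S) = exclusion_mean p (survival p t) S"
    if S: "S \<in> pre_configs"
      and eq: "\<And>T. T \<in> pre_configs \<Longrightarrow>
        of_bool (config_class T \<noteq> ground_state) * avoidance p t (config_class T) = survival p t T" for t S
  proof -
    have "avoidance p (Suc t) (config_class S) = measure_pmf.expectation (pre_step 0 p S)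
        (\<lambda>T. of_bool (config_class T \<noteq> ground_state) * avoidance p t (config_class T))"
      by (simp add: step_config_class[OF S])
    also have "\<dots> = measure_pmf.expectation (pre_step 0 p S) (survival p t)"
    proof (rule integral_cong_AE)
      show "AE T in pre_step 0 p S.
          of_bool (config_class T \<noteq> ground_state) * avoidance p t (config_class T) = survival p t T"
        using set_pre_step[OF S] by (intro AE_pmfI eq) blast
    qed simp_all
    also have "\<dots> = exclusion_mean p (survival p t) S"
      by (rule expectation_pre_step[OF S p])
    finally show ?thesis .
  qed
  {
    case 0
    show ?case by (rule step[OF 0]) (simp add: config_class_ground_iff)
  next
    case (Suc t)
    show ?case
      by (rule step[OF Suc.prems]) (simp only: Suc.IH survival.simps config_class_ground_iff)
  }
qed

lemma avoidance_nonneg: "0 \<le> avoidance p t C"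
  by (induction t arbitrary: C) (auto intro!: integral_nonneg_AE AE_pmfI)

lemma configs_representative:
  assumes "C \<in> configs"
  obtains S where "S \<in> pre_configs" "C = config_class S"
  using assms by (auto simp: configs_def config_class_def elim: quotientE)

lemma finite_set_step:
  assumes "C \<in> configs" shows "finite (set_pmf (step \<beta> p C))"
proof -
  obtain S where "S \<in> pre_configs" "C = config_class S"
    using configs_representative[OF assms] .
  then show ?thesis by (simp add: step_config_class finite_set_pre_step)
qed

text \<open>
  One step leads to finitely many configurations, so the constants of the survival bounds from
  each of them can be added.
\<close>

lemma avoidance_stretched_exponential:
  assumes p: "1/2 < p" "p \<le> 1" and C: "C \<in> configs"
  obtains A c where "0 < c" "0 \<le> A" "\<And>t. avoidance p (Suc t) C \<le> A * exp (- c * sqrt t)"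
proof -
  have p': "p \<in> {0..1}" using p by simp
  obtain c where c: "0 < c" "\<And>S. S \<in> pre_configs \<Longrightarrow> \<exists>A\<ge>0. \<forall>t. survival p t S \<le> A * exp (- c * sqrt t)"
    using survival_stretched_exponential[OF p] by blast
  then obtain A where A: "\<And>S. S \<in> pre_configs \<Longrightarrow> 0 \<le> A S"
      "\<And>S t. S \<in> pre_configs \<Longrightarrow> survival p t S \<le> A S * exp (- c * sqrt t)"
    by metis
  obtain S where S: "S \<in> pre_configs" "C = config_class S"
    using configs_representative[OF C] .
  let ?X = "set_pmf (pre_step 0 p S)"
  have X: "finite ?X" "?X \<subseteq> pre_configs"
    using finite_set_pre_step[OF S(1)] set_pre_step[OF S(1)] by auto
  show thesis
  proof (rule that[OF c(1)])
    show "0 \<le> (\<Sum>T\<in>?X. A T)" using X A by (intro sum_nonneg) auto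
    fix t
    have "avoidance p (Suc t) C = (\<Sum>T\<in>?X. survival p t T * pmf (pre_step 0 p S) T)"
      unfolding S(2) avoidance_Suc_eq_exclusion_mean[OF p' S(1)] expectation_pre_step[OF S(1) p', symmetric]
      using X by (subst integral_measure_pmf[of ?X]) (auto simp: mult.commute)
    also have "\<dots> \<le> (\<Sum>T\<in>?X. A T * exp (- c * sqrt t) * 1)"
      using X A(1) A(2)[of _ t] survival_bounds[OF p']
      by (intro sum_mono mult_mono pmf_le_1) auto
    finally show "avoidance p (Suc t) C \<le> (\<Sum>T\<in>?X. A T) * exp (- c * sqrt t)"
      by (simp add: sum_distrib_right)
  qed
qed

context exclusion_voter_process
begin

lemma event_state_eq [measurable]:
  "{\<omega> \<in> space M. \<xi> t \<omega> = C} \<in> events"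
proof (cases "C \<in> configs")
  case True
  have "\<xi> t -` {C} \<inter> space M \<in> events"
    using measurable_sets[OF random_state[of t], of "{C}"] True by simp
  also have "\<xi> t -` {C} \<inter> space M = {\<omega> \<in> space M. \<xi> t \<omega> = C}" by auto
  finally show ?thesis .
next
  case False
  then have "{\<omega> \<in> space M. \<xi> t \<omega> = C} = {}"
    using measurable_space[OF random_state[of t]] by force
  then show ?thesis by (simp only: sets.empty_sets)
qed

lemma prob_history_Suc:
  "prob {\<omega> \<in> space M. \<xi> (Suc n) \<omega> = C \<and> (\<forall>i\<le>n. \<xi> i \<omega> = c i)} =
    prob {\<omega> \<in> space M. \<forall>i\<le>n. \<xi> i \<omega> = c i} * pmf (step \<beta> p (c n)) C"
proof (cases "prob {\<omega> \<in> space M. \<forall>i\<le>n. \<xi> i \<omega> = c i} > 0")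
  case True
  then show ?thesis using markov[OF True, of C] by (simp add: cond_prob_def field_simps)
next
  case False
  then have null: "prob {\<omega> \<in> space M. \<forall>i\<le>n. \<xi> i \<omega> = c i} = 0"
    using measure_nonneg[of M] by (meson not_less order_antisym)
  have "prob {\<omega> \<in> space M. \<xi> (Suc n) \<omega> = C \<and> (\<forall>i\<le>n. \<xi> i \<omega> = c i)} \<le>
      prob {\<omega> \<in> space M. \<forall>i\<le>n. \<xi> i \<omega> = c i}"
    by (intro finite_measure_mono) auto
  then show ?thesis by (simp add: null measure_le_0_iff)
qed

text \<open>
  The Markov property over several steps, by induction on their number for all histories at
  once. Conditionally on the history up to \<open>n\<close>, the next state almost surely lies in the finite
  support of the one-step kernel, which makes the total probability formula a finite sum.
\<close>

lemma prob_avoid_ground_state: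
  assumes "\<beta> = 0" and "c n \<in> configs"
  shows "prob {\<omega> \<in> space M. (\<forall>i\<le>n. \<xi> i \<omega> = c i) \<and> (\<forall>i\<in>{n<..n + t}. \<xi> i \<omega> \<noteq> ground_state)} \<le>
    prob {\<omega> \<in> space M. \<forall>i\<le>n. \<xi> i \<omega> = c i} * avoidance p t (c n)"
  using assms(2)
proof (induction t arbitrary: n c)
  case (Suc t)
  let ?H = "{\<omega> \<in> space M. \<forall>i\<le>n. \<xi> i \<omega> = c i}"
  let ?X = "set_pmf (step \<beta> p (c n))"
  let ?E = "{\<omega> \<in> space M. (\<forall>i\<le>n. \<xi> i \<omega> = c i) \<and> (\<forall>i\<in>{n<..n + Suc t}. \<xi> i \<omega> \<noteq> ground_state)}"
  let ?next = "\<lambda>C. {\<omega> \<in> space M. \<xi> (Suc n) \<omega> = C \<and> (\<forall>i\<le>n. \<xi> i \<omega> = c i)}"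
  let ?F = "\<lambda>C. {\<omega> \<in> space M. (\<forall>i\<le>Suc n. \<xi> i \<omega> = (c(Suc n := C)) i) \<and>
      (\<forall>i\<in>{Suc n<..Suc n + t}. \<xi> i \<omega> \<noteq> ground_state)}"
  have X: "finite ?X" "?X \<subseteq> configs"
    using finite_set_step[OF Suc.prems] set_step[OF Suc.prems] by auto
  have hist: "{\<omega> \<in> space M. \<forall>i\<le>Suc n. \<xi> i \<omega> = (c(Suc n := C)) i} = ?next C" for C
    by (auto simp: le_Suc_eq)
  have events: "?H \<in> events" "\<And>C. ?next C \<in> events" "\<And>C. ?F C \<in> events"
    by measurable
  have unions: "(\<Union>C\<in>?X. ?next C) \<in> events" "(\<Union>C\<in>?X - {ground_state}. ?F C) \<in> events"
    using X events by (intro sets.finite_UN; simp)+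
  \<comment> \<open>one step later the state almost surely lies in the support\<close>
  have null: "prob (?H - (\<Union>C\<in>?X. ?next C)) = 0"
  proof -
    have "prob (\<Union>C\<in>?X. ?next C) = (\<Sum>C\<in>?X. prob (?next C))"
      using X events by (intro finite_measure_finite_Union) (auto simp: disjoint_family_on_def image_subset_iff)
    also have "\<dots> = prob ?H * (\<Sum>C\<in>?X. pmf (step \<beta> p (c n)) C)"
      by (simp add: prob_history_Suc sum_distrib_left)
    also have "\<dots> = prob ?H" using X by (simp add: sum_pmf_eq_1)
    finally have "prob (\<Union>C\<in>?X. ?next C) = prob ?H" .
    moreover have "prob (?H - (\<Union>C\<in>?X. ?next C)) = prob ?H - prob (\<Union>C\<in>?X. ?next C)"
      using events unions by (intro finite_measure_Diff) auto
    ultimately show ?thesis by simp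
  qed
  have "?E \<subseteq> (?H - (\<Union>C\<in>?X. ?next C)) \<union> (\<Union>C\<in>?X - {ground_state}. ?F C)"
  proof
    fix \<omega> assume w: "\<omega> \<in> ?E"
    show "\<omega> \<in> (?H - (\<Union>C\<in>?X. ?next C)) \<union> (\<Union>C\<in>?X - {ground_state}. ?F C)"
    proof (cases "\<xi> (Suc n) \<omega> \<in> ?X")
      case True
      moreover have "\<xi> (Suc n) \<omega> \<noteq> ground_state" using w by auto
      moreover have "\<omega> \<in> ?F (\<xi> (Suc n) \<omega>)" using w by (auto simp: le_Suc_eq)
      ultimately show ?thesis by blast
    qed (use w in auto)
  qed
  then have "prob ?E \<le> prob ((?H - (\<Union>C\<in>?X. ?next C)) \<union> (\<Union>C\<in>?X - {ground_state}. ?F C))"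
    using events unions by (intro finite_measure_mono sets.Un sets.Diff) 
  also have "\<dots> \<le> prob (?H - (\<Union>C\<in>?X. ?next C)) + prob (\<Union>C\<in>?X - {ground_state}. ?F C)"
    using events unions by (intro measure_Un_le sets.Diff)
  also have "\<dots> \<le> (\<Sum>C\<in>?X - {ground_state}. prob (?F C))"
    unfolding null add_0 using X events
    by (intro finite_measure_subadditive_finite) (auto simp: image_subset_iff)
  also have "\<dots> \<le> (\<Sum>C\<in>?X - {ground_state}. prob (?next C) * avoidance p t C)"
    using Suc.IH[of "c(Suc n := C)" "Suc n" for C] X unfolding hist
    by (intro sum_mono) (metis (no_types, lifting) DiffD1 fun_upd_same subsetD)
  also have "\<dots> = prob ?H * (\<Sum>C\<in>?X - {ground_state}. pmf (step \<beta> p (c n)) C * avoidance p t C)"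
    by (simp add: prob_history_Suc sum_distrib_left mult.assoc)
  also have "(\<Sum>C\<in>?X - {ground_state}. pmf (step \<beta> p (c n)) C * avoidance p t C) = avoidance p (Suc t) (c n)"
  proof -
    have "avoidance p (Suc t) (c n) =
        (\<Sum>C\<in>?X. pmf (step \<beta> p (c n)) C * (of_bool (C \<noteq> ground_state) * avoidance p t C))"
      using X \<open>\<beta> = 0\<close> by (subst avoidance.simps, subst integral_measure_pmf[of ?X]) auto
    also have "\<dots> = (\<Sum>C\<in>?X - {ground_state}. pmf (step \<beta> p (c n)) C * avoidance p t C)"
      using X by (intro sum.mono_neutral_cong_right) auto
    finally show ?thesis ..
  qed
  finally show ?case .
qed simp

end

text \<open>
  If the time is a finite \<open>k\<close>, the summand for \<open>t = k - 1\<close> alone suffices; if it is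
  infinite, all indicators are 1 and the series diverges.
\<close>

lemma enat_powr_relaxation_time_le:
  assumes "0 \<le> s"
  shows "enat_powr (relaxation_time \<xi> \<omega>) s \<le>
    (\<Sum>t. ennreal ((t + 1) powr s) * of_bool (\<forall>i\<in>{0<..t}. \<xi> i \<omega> \<noteq> ground_state))"
    (is "_ \<le> (\<Sum>t. ?g t)")
proof (cases "\<exists>t\<ge>1. \<xi> t \<omega> = ground_state")
  case True
  define k where "k = (LEAST t. 1 \<le> t \<and> \<xi> t \<omega> = ground_state)"
  have k: "1 \<le> k" "\<xi> k \<omega> = ground_state"
    using LeastI_ex[OF True[simplified Bex_def]] by (auto simp: k_def)
  have before: "\<xi> i \<omega> \<noteq> ground_state" if "1 \<le> i" "i < k" for i
    using not_less_Least[of i "\<lambda>t. 1 \<le> t \<and> \<xi> t \<omega> = ground_state"] that by (auto simp: k_def)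
  have "relaxation_time \<xi> \<omega> \<le> enat k"
    unfolding relaxation_time_def using k by (intro Inf_lower) auto
  moreover have "enat k \<le> relaxation_time \<xi> \<omega>"
    unfolding relaxation_time_def using before by (intro Inf_greatest) (force simp: not_less[symmetric])
  ultimately have "enat_powr (relaxation_time \<xi> \<omega>) s = ennreal (real k powr s)"
    by (simp add: enat_powr_def)
  also have "\<dots> = ?g (k - 1)"
  proof -
    have "\<forall>i\<in>{0<..k - 1}. \<xi> i \<omega> \<noteq> ground_state" using before by auto
    then show ?thesis using k by (simp add: of_nat_diff)
  qed
  also have "\<dots> \<le> (\<Sum>t. ?g t)"
    using sum_le_suminf[of ?g "{k - 1}"] by (simp del: sum_of_bool_mult_eq sum_mult_of_bool_eq)
  finally show ?thesis .
next
  case False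
  have "(\<Sum>t. ennreal ((t + 1) powr s) * of_bool (\<forall>i\<in>{0<..t}. \<xi> i \<omega> \<noteq> ground_state)) \<ge> (\<Sum>t. 1 :: ennreal)"
  proof (intro suminf_le summableI)
    fix t
    have "1 \<le> real (t + 1) powr s" using assms by (intro ge_one_powr_ge_zero) auto
    then show "1 \<le> ennreal ((t + 1) powr s) * of_bool (\<forall>i\<in>{0<..t}. \<xi> i \<omega> \<noteq> ground_state)"
    proof -
      have "\<xi> i \<omega> \<noteq> ground_state" if "i \<in> {0<..t}" for i
      proof -
        from that have "1 \<le> i" by simp
        with False show ?thesis by blast
      qed
      then show ?thesis using \<open>1 \<le> real (t + 1) powr s\<close> by (simp add: add.commute)
    qed
  qed
  moreover have "(\<Sum>t. 1 :: ennreal) = \<infinity>"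
    using nn_integral_count_space_nat[of "\<lambda>_. 1"] by simp
  ultimately show ?thesis by (simp add: top_unique)
qed

lemma summable_powr_stretched_exponential:
  assumes "0 < c"
  shows "summable (\<lambda>t. (real (Suc t) + 1) powr s * exp (- c * sqrt t))"
proof (rule summable_comparison_test_bigo)
  show "summable (\<lambda>t. norm (1 / real t ^ 2))"
    using inverse_power_summable[of 2, where 'a = real] by (simp add: inverse_eq_divide)
  show "(\<lambda>t. (real (Suc t) + 1) powr s * exp (- c * sqrt t)) \<in> O(\<lambda>t. 1 / real t ^ 2)"
    using assms by real_asymp
qed

theorem theorem5:
  fixes M :: "'w measure" and \<xi> :: "nat \<Rightarrow> 'w \<Rightarrow> (int \<Rightarrow> bool) set"
    and p s :: real and S\<^sub>0 :: "(int \<Rightarrow> bool) set"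
  assumes "p \<in> {1 / 2<..1}"
    and "exclusion_voter_process M 0 p \<xi>"
    and "S\<^sub>0 \<in> configs"
    and "measure M {\<omega> \<in> space M. \<xi> 0 \<omega> = S\<^sub>0} > 0"
    and "s \<in> {0..}"
  shows "(\<integral>\<^sup>+\<omega>. enat_powr (relaxation_time \<xi> \<omega>) s
            \<partial>uniform_measure M {\<omega> \<in> space M. \<xi> 0 \<omega> = S\<^sub>0}) < \<infinity>"
proof -
  interpret exclusion_voter_process M 0 p \<xi> by fact
  let ?H = "{\<omega> \<in> space M. \<xi> 0 \<omega> = S\<^sub>0}"
  let ?U = "uniform_measure M ?H"
  let ?T = "\<lambda>t. {\<omega> \<in> space M. \<forall>i\<in>{0<..t}. \<xi> i \<omega> \<noteq> ground_state}"
  let ?w = "\<lambda>t::nat. (real t + 1) powr s"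
  have T: "?T t \<in> events" for t by measurable
  have survive: "emeasure ?U (?T t) \<le> ennreal (avoidance p t S\<^sub>0)" for t
  proof -
    have "?H \<inter> ?T t = {\<omega> \<in> space M. (\<forall>i\<le>0. \<xi> i \<omega> = S\<^sub>0) \<and> (\<forall>i\<in>{0<..0 + t}. \<xi> i \<omega> \<noteq> ground_state)}"
      by auto
    then have "prob (?H \<inter> ?T t) \<le> prob ?H * avoidance p t S\<^sub>0"
      using prob_avoid_ground_state[of "\<lambda>_. S\<^sub>0" 0 t] assms(3) by simp
    then have "prob (?H \<inter> ?T t) / prob ?H \<le> avoidance p t S\<^sub>0"
      using assms(4) by (simp add: field_simps)
    then show ?thesis
      using T assms(4) by (simp add: emeasure_eq_measure divide_ennreal measure_nonneg ennreal_leI)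
  qed
  obtain A c where A: "0 < c" "0 \<le> A" "\<And>t. avoidance p (Suc t) S\<^sub>0 \<le> A * exp (- c * sqrt t)"
    using avoidance_stretched_exponential[OF _ _ assms(3), of p] assms(1)
    by (metis greaterThanAtMost_iff)
  have summable: "summable (\<lambda>t. ?w t * avoidance p t S\<^sub>0)"
  proof (subst summable_Suc_iff[symmetric], rule summable_comparison_test')
    show "summable (\<lambda>t. A * ((real (Suc t) + 1) powr s * exp (- c * sqrt t)))"
      by (intro summable_mult summable_powr_stretched_exponential A)
    show "norm (?w (Suc t) * avoidance p (Suc t) S\<^sub>0) \<le> A * ((real (Suc t) + 1) powr s * exp (- c * sqrt t))" for t
    proof -
      have "?w (Suc t) * avoidance p (Suc t) S\<^sub>0 \<le> ?w (Suc t) * (A * exp (- c * sqrt t))"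
        by (intro mult_left_mono A) auto
      moreover have "0 \<le> ?w (Suc t) * avoidance p (Suc t) S\<^sub>0"
        by (intro mult_nonneg_nonneg avoidance_nonneg) simp
      ultimately show ?thesis
        by (simp only: real_norm_def abs_of_nonneg mult_ac)
    qed
  qed
  have "(\<integral>\<^sup>+\<omega>. enat_powr (relaxation_time \<xi> \<omega>) s \<partial>?U) \<le>
      (\<integral>\<^sup>+\<omega>. (\<Sum>t. ennreal (?w t) * indicator (?T t) \<omega>) \<partial>?U)"
  proof (rule nn_integral_mono)
    fix \<omega> assume "\<omega> \<in> space ?U"
    then have "of_bool (\<forall>i\<in>{0<..t}. \<xi> i \<omega> \<noteq> ground_state) = (indicator (?T t) \<omega> :: ennreal)" for t
      by (simp add: indicator_def)
    then show "enat_powr (relaxation_time \<xi> \<omega>) s \<le> (\<Sum>t. ennreal (?w t) * indicator (?T t) \<omega>)"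
      using enat_powr_relaxation_time_le[of s \<xi> \<omega>] assms(5) by (simp add: add.commute)
  qed
  also have "\<dots> = (\<Sum>t. ennreal (?w t) * emeasure ?U (?T t))"
    using T by (subst nn_integral_suminf) (auto simp: nn_integral_cmult_indicator)
  also have "\<dots> \<le> (\<Sum>t. ennreal (?w t) * ennreal (avoidance p t S\<^sub>0))"
    by (intro suminf_le summableI mult_left_mono survive) auto
  also have "\<dots> = ennreal (\<Sum>t. ?w t * avoidance p t S\<^sub>0)"
    using summable avoidance_nonneg by (simp add: ennreal_mult[symmetric] suminf_ennreal2)
  also have "\<dots> < \<infinity>" by simp
  finally show ?thesis .
qed

end
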